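(* Let $\nu>-\frac12$ and let $\mathbf{m}=\begin{pmatrix}a&b\\c&d\end{pmatrix}\in SL(2,\mathbb{R})$ with $b\neq0$. Let $f,g,h$ be measurable functions on $[0,+\infty[$. Assuming that all integrals in question exist (that is, at the points considered, the multiple integrals obtained by inserting the definitions of the translations and convolutions on both sides converge absolutely), one has, with $*$ denoting $\underset{\nu,\mathbf{m}}{*}$: 1) $f*g=g*f$. 2) For $x>0$, $T_x^{\nu,\mathbf{m}}(f*g)=\left[T_x^{\nu,\mathbf{m}}f\right]*g=f*\left[T_x^{\nu,\mathbf{m}}g\right]$. 3) $(f*g)*h=f*(g*h)$.
   Context: For $x,y>0$ and $f$ measurable on $[0,+\infty[$, the Bessel translation is $$T_x^\nu f(y)=\int_0^{+\infty}f(z)\,\mathcal{W}_\nu(x,y,z)\,z^{2\nu+1}dz,\qquad \mathcal{W}_\nu(x,y,z)=\frac{2^{2\nu-1}\Gamma(\nu+1)}{\sqrt\pi\,\Gamma(\nu+1/2)}\frac{\Delta^{2\nu-1}}{(xyz)^{2\nu}}\mathbf 1_{[|x-y|,x+y]}(z),$$ where $\Delta=\frac14\sqrt{(x+y+z)(x+y-z)(x-y+z)(y+z-x)}$; equivalently $T_x^\nu f(y)=\frac{\Gamma(\nu+1)}{\sqrt\pi\,\Gamma(\nu+1/2)}\int_0^\pi f\left(\sqrt{x^2+y^2-2xy\cos\theta}\right)(\sin\theta)^{2\nu}d\theta$. The translation associated with $\mathbf{m}$ is $T_x^{\nu,\mathbf{m}}f(y)=e^{\frac i2\frac db(x^2+y^2)}T_x^\nu\left[s\mapsto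 e^{-\frac i2\frac db s^2}f(s)\right](y)$. The generalized convolution is $$\left(f\underset{\nu,\mathbf{m}}{*}g\right)(x)=\int_0^{+\infty}\left[T_x^{\nu,\mathbf{m}}f(y)\right]\left[e^{-i\frac db y^2}g(y)\right]y^{2\nu+1}dy$$ for all $x$ such that the integral exists. *)

theory Defs
  imports "HOL-Analysis.Analysis"
begin

abbreviation half_line :: "real measure" where
  "half_line \<equiv> lebesgue_on {0..}"

definition bessel_Delta :: "real \<Rightarrow> real \<Rightarrow> real \<Rightarrow> real" where
  "bessel_Delta x y z = sqrt ((x + y + z) * (x + y - z) * (x - y + z) * (y + z - x)) / 4"

text \<open>Meaningful for \<open>x, y > 0\<close> only. Conventions for division by zero and for powers of
  zero matter here only at \<open>z = 0\<close>, \<open>z = \<bar>x - y\<bar>\<close> and \<open>z = x + y\<close>, a null set in \<open>z\<close>.\<close>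

definition bessel_W :: "real \<Rightarrow> real \<Rightarrow> real \<Rightarrow> real \<Rightarrow> real" where
  "bessel_W \<nu> x y z =
     2 powr (2 * \<nu> - 1) * Gamma (\<nu> + 1) / (sqrt pi * Gamma (\<nu> + 1/2))
     * (bessel_Delta x y z powr (2 * \<nu> - 1) / (x * y * z) powr (2 * \<nu>))
     * indicator {\<bar>x - y\<bar>..x + y} z"

definition bessel_translation_integrand ::
  "real \<Rightarrow> real \<Rightarrow> (real \<Rightarrow> complex) \<Rightarrow> real \<Rightarrow> real \<Rightarrow> complex" where
  "bessel_translation_integrand \<nu> x f y z =
     f z * of_real (bessel_W \<nu> x y z) * of_real (z powr (2 * \<nu> + 1))"

definition bessel_translation ::
  "real \<Rightarrow> real \<Rightarrow> (real \<Rightarrow> complex) \<Rightarrow> real \<Rightarrow> complex" where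
  "bessel_translation \<nu> x f y = (LINT z|half_line. bessel_translation_integrand \<nu> x f y z)"

definition chirp :: "real^2^2 \<Rightarrow> real \<Rightarrow> complex" where
  "chirp m t = exp (\<i> * of_real (m $ 2 $ 2 / m $ 1 $ 2 * t))"

definition m_translation ::
  "real \<Rightarrow> real^2^2 \<Rightarrow> real \<Rightarrow> (real \<Rightarrow> complex) \<Rightarrow> real \<Rightarrow> complex" where
  "m_translation \<nu> m x f y =
     chirp m ((x\<^sup>2 + y\<^sup>2) / 2) * bessel_translation \<nu> x (\<lambda>s. chirp m (- (s\<^sup>2) / 2) * f s) y"

definition m_conv ::
  "real \<Rightarrow> real^2^2 \<Rightarrow> (real \<Rightarrow> complex) \<Rightarrow> (real \<Rightarrow> complex) \<Rightarrow> real \<Rightarrow> complex" where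
  "m_conv \<nu> m f g x =
     (LINT y|half_line.
        m_translation \<nu> m x f y * (chirp m (- (y\<^sup>2)) * g y) * of_real (y powr (2 * \<nu> + 1)))"

text \<open>The integrands of the multiple integrals obtained by inserting the definitions.
  Integrands of iterated translations and convolutions arise by substitution: for instance
  \<open>T\<^sub>x (f * g) (y)\<close> is the iterated integral over \<open>s\<close>, \<open>t\<close>, \<open>z\<close> of
  \<open>m_translation_integrand \<nu> m x (\<lambda>s. m_conv_integrand \<nu> m f g s t z) y s\<close>.\<close>

definition m_translation_integrand ::
  "real \<Rightarrow> real^2^2 \<Rightarrow> real \<Rightarrow> (real \<Rightarrow> complex) \<Rightarrow> real \<Rightarrow> real \<Rightarrow> complex" where
  "m_translation_integrand \<nu> m x f y z =
     chirp m ((x\<^sup>2 + y\<^sup>2) / 2)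
     * bessel_translation_integrand \<nu> x (\<lambda>s. chirp m (- (s\<^sup>2) / 2) * f s) y z"

definition m_conv_integrand ::
  "real \<Rightarrow> real^2^2 \<Rightarrow> (real \<Rightarrow> complex) \<Rightarrow> (real \<Rightarrow> complex) \<Rightarrow> real \<Rightarrow> real \<Rightarrow> real \<Rightarrow> complex" where
  "m_conv_integrand \<nu> m f g x y z =
     m_translation_integrand \<nu> m x f y z * (chirp m (- (y\<^sup>2)) * g y) * of_real (y powr (2 * \<nu> + 1))"

lemma m_translation_eq_integral:
  "m_translation \<nu> m x f y = (LINT z|half_line. m_translation_integrand \<nu> m x f y z)"
  by (simp add: m_translation_def bessel_translation_def m_translation_integrand_def)

lemma m_conv_eq_integral:
  "m_conv \<nu> m f g x = (LINT y|half_line. LINT z|half_line. m_conv_integrand \<nu> m f g x y z)"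
  by (simp add: m_conv_def m_translation_eq_integral m_conv_integrand_def)

end

theory Submission
  imports Defs "HOL-Probability.Levy"
begin

text \<open>Put \<open>F z = exp (- i d z\<^sup>2 / (2 b)) f z\<close>. In every integrand of the theorem the phases combine into
  one phase outside and the functions \<open>F, G, H\<close>, so everything reduces to the classical Bessel
  translation with kernel \<open>W\<close> and weight \<open>z\<^bsup>2\<nu>+1\<^esup>\<close>. After the integrals have been reordered by Fubini,
  commutativity is the symmetry \<open>W x y z = W x z y\<close> (\<open>bessel_W_rotate\<close>), and each of the other identities
  compares two values of \<open>K x y t z = \<integral> W x y s * W s t z * s\<^bsup>2\<nu>+1\<^esup> ds\<close> in which \<open>x, y, t\<close> are permuted.
  So all that has to be shown is that \<open>K\<close> is symmetric in \<open>x, y, t\<close> for almost every \<open>z\<close>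
  (\<open>bessel_kernel_cyclic\<close>).

  The function \<open>z \<mapsto> W x y z * z\<^bsup>2\<nu>+1\<^esup>\<close> is a probability density, the law of
  \<open>z = sqrt (x\<^sup>2 + y\<^sup>2 - 2 x y cos \<theta>)\<close> for an angle with density proportional to \<open>(sin \<theta>)\<^bsup>2\<nu>\<^esup>\<close>. Its even moments
  can be computed (\<open>integral_even_power_bessel_W\<close>): with
  \<open>U\<^sub>x = \<Sum>n. x\<^bsup>2n\<^esup> / (n! (\<nu>+1)\<^sub>n) T\<^bsup>n\<^esup>\<close> the \<open>2n\<close>-th moment is \<open>n! (\<nu>+1)\<^sub>n\<close> times the coefficient of \<open>T\<^bsup>n\<^esup>\<close>
  in \<open>U\<^sub>x U\<^sub>y\<close>. This is the product formula \<open>j (\<lambda>x) j (\<lambda>y) = T\<^sub>x (j (\<lambda>\<cdot>)) (y)\<close> of the normalised Bessel function,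
  read coefficient by coefficient, and it comes down to the Chu--Vandermonde identity. Integrating
  once more, the even moments of \<open>K x y t z * z\<^bsup>2\<nu>+1\<^esup>\<close> are given in the same way by \<open>U\<^sub>x U\<^sub>y U\<^sub>t\<close>, an expression
  symmetric in \<open>x, y, t\<close>. As \<open>z\<close> stays in \<open>[0, x + y + t]\<close>, the moments of \<open>z\<^sup>2\<close> determine its law
  (\<open>moments_determine_distribution\<close>), and therefore the density.\<close>

section \<open>Coefficients of products of Bessel functions\<close>

text \<open>The hypergeometric series \<open>\<^sub>0F\<^sub>1(c; X T)\<close> in the formal variable \<open>T\<close>. For \<open>c = \<nu> + 1\<close> and \<open>X = x\<^sup>2\<close> it is the
  normalised Bessel function \<open>j\<^sub>\<nu>(2 i x sqrt T)\<close>.\<close>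
definition bessel_fps :: "real \<Rightarrow> real \<Rightarrow> real fps" where
  "bessel_fps c X = Abs_fps (\<lambda>n. X ^ n / (fact n * pochhammer c n))"

text \<open>The moments of \<open>cos \<theta>\<close> when \<open>\<theta>\<close> has density proportional to \<open>(sin \<theta>)\<^bsup>2c-2\<^esup>\<close> on \<open>[0, \<pi>]\<close>; see
  \<open>beta_moment_eq_cos_moment\<close>.\<close>
definition cos_moment :: "real \<Rightarrow> nat \<Rightarrow> real" where
  "cos_moment c k =
     (if even k then pochhammer (1/2) (k div 2) / pochhammer c (k div 2) else 0)"

lemma pochhammer_minus_nat:
  assumes "j \<le> k"
  shows "pochhammer (- real k) j = (-1) ^ j * fact k / fact (k - j)"
proof -
  have "pochhammer (1::real) k = pochhammer 1 (k - j) * pochhammer (1 + real (k - j)) j"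
    using pochhammer_product[of "k - j" k "1::real"] assms by simp
  then show ?thesis
    using assms by (simp add: pochhammer_minus of_nat_diff flip: pochhammer_fact) (simp add: field_simps)
qed

text \<open>The Chu--Vandermonde identity for \<open>\<^sub>2F\<^sub>1(-k, -l; c; 1)\<close>, in a form that shows the symmetry in \<open>k\<close> and \<open>l\<close>.\<close>
lemma sum_inverse_fact_pochhammer:
  fixes c :: real
  assumes "c > 0"
  shows "(\<Sum>j\<le>min k l. 1 / (fact (k - j) * fact (l - j) * fact j * pochhammer c j))
       = pochhammer c (k + l) / (fact k * fact l * pochhammer c k * pochhammer c l)"
proof -
  have c: "\<forall>i\<in>{0..<k}. c \<noteq> - real i" using assms by auto
  have "(\<Sum>j\<le>min k l. 1 / (fact (k - j) * fact (l - j) * fact j * pochhammer c j))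
      = (\<Sum>j\<le>min k l. (pochhammer (- real l) j * pochhammer (- real k) j)
            / (fact j * pochhammer c j)) / (fact k * fact l)"
    unfolding sum_divide_distrib
    by (intro sum.cong refl) (simp add: pochhammer_minus_nat field_simps flip: power_add power_mult_distrib)
  also have "(\<Sum>j\<le>min k l. (pochhammer (- real l) j * pochhammer (- real k) j) / (fact j * pochhammer c j))
      = (\<Sum>j=0..k. (pochhammer (- real l) j * pochhammer (- real k) j) / (fact j * pochhammer c j))"
    by (intro sum.mono_neutral_left) (auto simp: pochhammer_of_nat_eq_0_iff)
  also have "\<dots> = pochhammer (c + l) k / pochhammer c k"
    using Vandermonde_pochhammer[OF c, of "- real l"] by simp
  also have "pochhammer (c + l) k = pochhammer c (k + l) / pochhammer c l"
    using pochhammer_product'[of c l k] pochhammer_pos[OF assms, of l] by (simp add: add.commute field_simps)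
  finally show ?thesis by (simp add: field_simps)
qed

lemma exp_coeff_binomial:
  fixes X Y :: real
  shows "(X + Y) ^ n / fact n = (\<Sum>k\<le>n. X ^ k / fact k * (Y ^ (n - k) / fact (n - k)))"
  by (simp add: binomial_ring sum_divide_distrib binomial_fact field_simps)

lemma double_fact_half: "fact (2 * j) = 4 ^ j * pochhammer (1/2 :: real) j * fact j"
  using pochhammer_double[of "1/2::real" j] by (simp add: pochhammer_fact power_mult)

lemma sum_even_index:
  fixes h :: "nat \<Rightarrow> real"
  assumes "\<And>m. odd m \<Longrightarrow> h m = 0"
  shows "(\<Sum>m\<le>n. h m) = (\<Sum>j\<le>n div 2. h (2 * j))"
proof -
  have "(\<Sum>m\<le>n. h m) = (\<Sum>m\<in>(\<lambda>j. 2 * j) ` {..n div 2}. h m)"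
  proof (intro sum.mono_neutral_right ballI)
    fix i assume i: "i \<in> {..n} - (*) 2 ` {..n div 2}"
    have "odd i"
    proof
      assume "even i"
      then obtain j where "i = 2 * j" by (elim evenE)
      then show False using i by auto
    qed
    then show "h i = 0" by (rule assms)
  qed auto
  also have "\<dots> = (\<Sum>j\<le>n div 2. h (2 * j))"
    by (subst sum.reindex) (auto simp: inj_on_def)
  finally show ?thesis .
qed

text \<open>On the left is the mean of \<open>(X + Y + 2 r cos \<theta>)\<^bsup>n\<^esup>\<close>. Odd moments vanish, and \<open>r\<^bsup>2j\<^esup> = X\<^bsup>j\<^esup> Y\<^bsup>j\<^esup>\<close>, so the mean is a
  polynomial in \<open>X\<close> and \<open>Y\<close>. A monomial \<open>X\<^bsup>k\<^esup> Y\<^bsup>n-k\<^esup>\<close> arises from \<open>X\<^bsup>j\<^esup> Y\<^bsup>j\<^esup>\<close> times \<open>X\<^bsup>k-j\<^esup> Y\<^bsup>n-k-j\<^esup>\<close> for each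
  \<open>j \<le> min k (n - k)\<close>, and the sum over \<open>j\<close> is the Chu--Vandermonde sum.\<close>
lemma cos_moment_binomial_sum:
  fixes c X Y r :: real
  assumes c: "c > 0" and r: "r\<^sup>2 = X * Y"
  shows "(\<Sum>m\<le>n. real (n choose m) * (2 * r) ^ m * (X + Y) ^ (n - m) * cos_moment c m)
       = fact n * pochhammer c n * fps_nth (bessel_fps c X * bessel_fps c Y) n"
    (is "?L = ?R")
proof -
  have "?L = fact n * (\<Sum>m\<le>n. (X + Y) ^ (n - m) / fact (n - m) * ((2 * r) ^ m * cos_moment c m / fact m))"
    by (simp add: sum_distrib_left binomial_fact field_simps)
  also have "(\<Sum>m\<le>n. (X + Y) ^ (n - m) / fact (n - m) * ((2 * r) ^ m * cos_moment c m / fact m))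
      = (\<Sum>j\<le>n div 2. (X + Y) ^ (n - 2 * j) / fact (n - 2 * j) * ((2 * r) ^ (2 * j) * cos_moment c (2 * j) / fact (2 * j)))"
    by (intro sum_even_index) (simp add: cos_moment_def)
  also have "\<dots> = (\<Sum>j\<le>n div 2. (X + Y) ^ (n - 2 * j) / fact (n - 2 * j) * ((X * Y) ^ j / (fact j * pochhammer c j)))"
  proof (intro sum.cong refl)
    fix j
    have "(2 * r) ^ (2 * j) = 4 ^ j * (X * Y) ^ j"
      by (simp add: power_mult power_mult_distrib flip: r)
    moreover have "pochhammer (1/2 :: real) j \<noteq> 0"
      using pochhammer_pos[of "1/2::real" j] by simp
    ultimately have "(2 * r) ^ (2 * j) * cos_moment c (2 * j) / fact (2 * j) = (X * Y) ^ j / (fact j * pochhammer c j)"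
      by (simp add: cos_moment_def double_fact_half)
    then show "(X + Y) ^ (n - 2 * j) / fact (n - 2 * j) * ((2 * r) ^ (2 * j) * cos_moment c (2 * j) / fact (2 * j))
       = (X + Y) ^ (n - 2 * j) / fact (n - 2 * j) * ((X * Y) ^ j / (fact j * pochhammer c j))" by simp
  qed
  also have "\<dots> = (\<Sum>j\<le>n div 2. \<Sum>a\<le>n - 2 * j.
      X ^ (a + j) * Y ^ (n - (a + j)) / (fact a * fact (n - 2 * j - a) * fact j * pochhammer c j))"
    unfolding exp_coeff_binomial sum_distrib_right
  proof (intro sum.cong refl)
    fix j a assume "j \<in> {..n div 2}" "a \<in> {..n - 2 * j}"
    then have "n - (a + j) = n - 2 * j - a + j" by auto
    then show "X ^ a / fact a * (Y ^ (n - 2 * j - a) / fact (n - 2 * j - a)) * ((X * Y) ^ j / (fact j * pochhammer c j))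
      = X ^ (a + j) * Y ^ (n - (a + j)) / (fact a * fact (n - 2 * j - a) * fact j * pochhammer c j)"
      by (simp add: power_add power_mult_distrib mult_ac)
  qed
  also have "\<dots> = (\<Sum>k\<le>n. \<Sum>j\<le>min k (n - k).
      X ^ k * Y ^ (n - k) / (fact (k - j) * fact (n - k - j) * fact j * pochhammer c j))"
    unfolding sum.Sigma[OF finite_atMost ballI[OF finite_atMost]]
  \<comment> \<open>The exponent of \<open>X\<close> becomes the outer index: \<open>k = a + j\<close>.\<close>
  proof (intro sum.reindex_bij_witness[where i = "\<lambda>(k, j). (j, k - j)" and j = "\<lambda>(j, a). (a + j, j)"], goal_cases)
    case (5 p)
    obtain j a where [simp]: "p = (j, a)" by (cases p)
    have "n - (a + j) - j = n - 2 * j - a" by simp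
    then show ?case by simp
  qed (auto simp: min_def split: if_splits)
  also have "\<dots> = (\<Sum>k\<le>n. X ^ k * Y ^ (n - k) * (\<Sum>j\<le>min k (n - k).
      1 / (fact (k - j) * fact (n - k - j) * fact j * pochhammer c j)))"
    by (simp add: sum_distrib_left)
  also have "\<dots> = (\<Sum>k\<le>n. pochhammer c n * (X ^ k / (fact k * pochhammer c k) * (Y ^ (n - k) / (fact (n - k) * pochhammer c (n - k)))))"
    unfolding sum_inverse_fact_pochhammer[OF c]
    by (intro sum.cong refl) (simp add: field_simps)
  also have "\<dots> = pochhammer c n * fps_nth (bessel_fps c X * bessel_fps c Y) n"
    by (simp add: bessel_fps_def fps_mult_nth sum_distrib_left atMost_atLeast0)
  finally show ?thesis by simp
qed

section \<open>Even moments of the translation kernel\<close>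

text \<open>The density on \<open>[0, 1]\<close> of \<open>t = (1 - cos \<theta>) / 2\<close> when \<open>\<theta>\<close> has density proportional to \<open>(sin \<theta>)\<^bsup>2\<nu>\<^esup>\<close>; then
  \<open>x\<^sup>2 + y\<^sup>2 - 2 x y cos \<theta> = (x - y)\<^sup>2 + 4 x y t\<close>.\<close>
definition beta_weight :: "real \<Rightarrow> real \<Rightarrow> real" where
  "beta_weight \<nu> t = 4 powr \<nu> * Gamma (\<nu> + 1) / (sqrt pi * Gamma (\<nu> + 1/2))
     * (t * (1 - t)) powr (\<nu> - 1/2)"

lemma Gamma_legendre_duplication_real:
  fixes x :: real
  assumes "x > 0"
  shows "Gamma x * Gamma (x + 1/2) = 2 powr (1 - 2 * x) * sqrt pi * Gamma (2 * x)"
proof -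
  have "complex_of_real (Gamma x * Gamma (x + 1/2)) = Gamma (of_real x) * Gamma (of_real x + 1/2)"
    using Gamma_complex_of_real[of x] Gamma_complex_of_real[of "x + 1/2"] by simp
  also have "\<dots> = exp ((1 - 2 * of_real x) * of_real (ln 2)) * of_real (sqrt pi) * Gamma (2 * of_real x)"
  proof (rule Gamma_legendre_duplication)
    have "complex_of_real x \<notin> \<int>\<^sub>\<le>\<^sub>0" "complex_of_real (x + 1/2) \<notin> \<int>\<^sub>\<le>\<^sub>0"
      using assms unfolding of_real_in_nonpos_Ints_iff by auto
    then show "complex_of_real x \<notin> \<int>\<^sub>\<le>\<^sub>0" "complex_of_real x + 1 / 2 \<notin> \<int>\<^sub>\<le>\<^sub>0"
      by auto
  qed
  also have "\<dots> = complex_of_real (2 powr (1 - 2 * x) * sqrt pi * Gamma (2 * x))"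
    using Gamma_complex_of_real[of "2 * x"] by (simp add: powr_def exp_of_real[symmetric])
  finally show ?thesis unfolding of_real_eq_iff .
qed

lemma beta_weight_eq:
  assumes "t \<in> {0..1}"
  shows "beta_weight \<nu> t = 4 powr \<nu> * Gamma (\<nu> + 1) / (sqrt pi * Gamma (\<nu> + 1/2))
     * (t powr ((\<nu> + 1/2) - 1) * (1 - t) powr ((\<nu> + 1/2) - 1))"
  using assms by (simp add: beta_weight_def powr_mult)

lemma beta_weight_nonneg: "\<nu> > -1/2 \<Longrightarrow> beta_weight \<nu> t \<ge> 0"
  by (auto simp: beta_weight_def intro!: mult_nonneg_nonneg divide_nonneg_nonneg Gamma_real_nonneg)

lemma set_integrable_beta_weight:
  assumes "\<nu> > -1/2"
  shows "set_integrable lborel {0..1} (beta_weight \<nu>)"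
  by (subst set_integrable_cong[OF refl refl beta_weight_eq], assumption)
     (intro set_integrable_mult_right integrable_Beta; use assms in simp)

text \<open>The constant in front is \<open>1 / B(\<nu> + 1/2, \<nu> + 1/2)\<close>, by the duplication formula.\<close>
lemma integral_beta_weight:
  assumes "\<nu> > -1/2"
  shows "(LINT t:{0..1}|lborel. beta_weight \<nu> t) = 1"
proof -
  define a where "a = \<nu> + 1/2"
  have a: "a > 0" and a1: "\<nu> + 1 = a + 1/2" using assms by (simp_all add: a_def)
  let ?C = "4 powr \<nu> * Gamma (a + 1/2) / (sqrt pi * Gamma a)"
  have "(beta_weight \<nu> has_integral ?C * Beta a a) {0..1}"
    by (rule has_integral_eq[OF _ has_integral_mult_right[OF has_integral_Beta_real[OF a a]]])
       (simp only: beta_weight_eq a1 flip: a_def)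
  then have "(LINT t:{0..1}|lborel. beta_weight \<nu> t) = ?C * Beta a a"
    using set_borel_integral_eq_integral(2)[OF set_integrable_beta_weight[OF assms]]
    by (simp only: integral_unique)
  also have "\<dots> = 4 powr \<nu> * (Gamma a * Gamma (a + 1/2)) / (sqrt pi * Gamma (2 * a))"
    using Gamma_real_pos[OF a] by (simp add: Beta_def divide_simps flip: mult_2)
  also have "4 powr \<nu> * (Gamma a * Gamma (a + 1/2)) = sqrt pi * Gamma (2 * a)"
  proof -
    have "(4::real) powr \<nu> = 2 powr (2 * \<nu>)"
      using powr_powr[of 2 2 \<nu>] by simp
    moreover have "1 - 2 * a = - (2 * \<nu>)" by (simp add: a_def)
    ultimately show ?thesis
      unfolding Gamma_legendre_duplication_real[OF a] by (simp add: powr_minus)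
  qed
  also have "sqrt pi * Gamma (2 * a) / (sqrt pi * Gamma (2 * a)) = 1"
  proof -
    have "Gamma (2 * a) > 0" using a by (intro Gamma_real_pos) simp
    then show ?thesis by simp
  qed
  finally show ?thesis .
qed

definition beta_moment :: "real \<Rightarrow> nat \<Rightarrow> real" where
  "beta_moment \<nu> k = (LINT t:{0..1}|lborel. (2 * t - 1) ^ k * beta_weight \<nu> t)"

lemma set_integrable_beta_weight_poly:
  assumes "\<nu> > -1/2" and cont: "continuous_on {0..1} p"
  shows "set_integrable lborel {0..1} (\<lambda>t. p t * beta_weight \<nu> t)"
proof -
  have "compact (p ` {0..1})" using cont by (intro compact_continuous_image) auto
  then obtain B where B: "\<And>t. t \<in> {0..1} \<Longrightarrow> \<bar>p t\<bar> \<le> B"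
    using compact_imp_bounded by (force simp: bounded_iff)
  have "set_integrable lborel {0..1} (\<lambda>t. B * beta_weight \<nu> t)"
    by (intro set_integrable_mult_right set_integrable_beta_weight assms)
  then show ?thesis
  proof (rule set_integrable_bound)
    have p: "set_borel_measurable lborel {0..1} p"
      using set_measurable_continuous_on[OF _ cont] by (simp add: set_borel_measurable_def)
    have "(\<lambda>t. (indicator {0..1} t *\<^sub>R p t) * beta_weight \<nu> t) \<in> borel_measurable lborel"
      using p unfolding beta_weight_def set_borel_measurable_def by measurable
    then show "set_borel_measurable lborel {0..1} (\<lambda>t. p t * beta_weight \<nu> t)"
      by (simp add: set_borel_measurable_def mult.assoc)
    show "AE t in lborel. t \<in> {0..1} \<longrightarrow> norm (p t * beta_weight \<nu> t) \<le> norm (B * beta_weight \<nu> t)"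
      using B beta_weight_nonneg[OF assms(1)]
      by (auto simp: abs_mult intro!: AE_I2 mult_right_mono order_trans[OF B abs_ge_self])
  qed
qed

text \<open>The function \<open>(2t - 1)\<^bsup>k\<^esup> (t (1 - t))\<^bsup>\<nu>+1/2\<^esup>\<close> vanishes at both endpoints because \<open>\<nu> + 1/2 > 0\<close>, so its derivative
  has integral \<open>0\<close>; for \<open>k = 0\<close> this says that the first moment vanishes.\<close>
lemma beta_moment_rec:
  assumes \<nu>: "\<nu> > -1/2"
  shows "real k * beta_moment \<nu> (k - 1) = (real k + 2 * \<nu> + 1) * beta_moment \<nu> (k + 1)"
proof -
  let ?C = "4 powr \<nu> * Gamma (\<nu> + 1) / (sqrt pi * Gamma (\<nu> + 1/2))"
  let ?F = "\<lambda>t::real. ?C * ((2 * t - 1) ^ k * (t * (1 - t)) powr (\<nu> + 1/2))"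
  let ?p = "\<lambda>t::real. (real k * (2 * t - 1) ^ (k - 1) - (real k + 2 * \<nu> + 1) * (2 * t - 1) ^ (k + 1)) / 2"
  have ftc: "((\<lambda>t. ?p t * beta_weight \<nu> t) has_integral (?F 1 - ?F 0)) {0..1}"
  proof (rule fundamental_theorem_of_calculus_interior)
    show "continuous_on {0..1} ?F"
      using \<nu> by (intro continuous_intros continuous_on_powr') auto
    fix t :: real assume t: "t \<in> {0<..<1}"
    then have pos: "t * (1 - t) > 0" by simp
    let ?w = "(t * (1 - t)) powr (\<nu> - 1/2)"
    have "((\<lambda>t. (2 * t - 1) ^ k) has_real_derivative real k * (2 * t - 1) ^ (k - 1) * 2) (at t)"
      by (auto intro!: derivative_eq_intros)
    moreover have "((\<lambda>t. (t * (1 - t)) powr (\<nu> + 1/2)) has_real_derivative (\<nu> + 1/2) * ?w * (1 - 2 * t)) (at t)"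
      using DERIV_fun_powr[of "\<lambda>t. t * (1 - t)" "1 - 2 * t" t "\<nu> + 1/2"] pos
      by (auto intro!: derivative_eq_intros)
    ultimately have "(?F has_real_derivative
          ?C * (real k * (2 * t - 1) ^ (k - 1) * 2 * (t * (1 - t)) powr (\<nu> + 1/2)
             + (\<nu> + 1/2) * ?w * (1 - 2 * t) * (2 * t - 1) ^ k)) (at t)"
      by (intro DERIV_cmult DERIV_mult)
    also have "(t * (1 - t)) powr (\<nu> + 1/2) = (t * (1 - t)) * ?w"
      using powr_add[of "t * (1 - t)" 1 "\<nu> - 1/2"] pos by (simp add: add.commute)
    also have "?C * (real k * (2 * t - 1) ^ (k - 1) * 2 * ((t * (1 - t)) * ?w)
             + (\<nu> + 1/2) * ?w * (1 - 2 * t) * (2 * t - 1) ^ k)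
        = (real k * (2 * t - 1) ^ (k - 1) * 2 * (t * (1 - t)) + (2 * t - 1) ^ k * ((\<nu> + 1/2) * (1 - 2 * t))) * (?C * ?w)"
      by (simp only: distrib_left distrib_right mult_ac)
    also have "real k * (2 * t - 1) ^ (k - 1) * 2 * (t * (1 - t)) + (2 * t - 1) ^ k * ((\<nu> + 1/2) * (1 - 2 * t)) = ?p t"
      by (cases k) (simp_all add: field_simps)
    finally have "(?F has_real_derivative ?p t * beta_weight \<nu> t) (at t)"
      by (simp add: beta_weight_def)
    then show "(?F has_vector_derivative ?p t * beta_weight \<nu> t) (at t)"
      by (simp add: has_real_derivative_iff_has_vector_derivative)
  qed simp
  have "integral {0..1} (\<lambda>t. ?p t * beta_weight \<nu> t) = ?F 1 - ?F 0"
    using ftc by (rule integral_unique)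
  also have "\<dots> = 0"
    using \<nu> by simp
  finally have "integral {0..1} (\<lambda>t. ?p t * beta_weight \<nu> t) = 0" .
  moreover have "(LINT t:{0..1}|lborel. ?p t * beta_weight \<nu> t) = integral {0..1} (\<lambda>t. ?p t * beta_weight \<nu> t)"
    by (intro set_borel_integral_eq_integral(2) set_integrable_beta_weight_poly \<nu> continuous_intros) auto
  moreover have "(LINT t:{0..1}|lborel. ?p t * beta_weight \<nu> t)
     = (LINT t:{0..1}|lborel. real k / 2 * ((2 * t - 1) ^ (k - 1) * beta_weight \<nu> t)
        - (real k + 2 * \<nu> + 1) / 2 * ((2 * t - 1) ^ (k + 1) * beta_weight \<nu> t))"
    by (intro set_lebesgue_integral_cong) (auto simp: field_simps)
  moreover have "\<dots> = real k / 2 * beta_moment \<nu> (k - 1) - (real k + 2 * \<nu> + 1) / 2 * beta_moment \<nu> (k + 1)"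
    unfolding beta_moment_def
    by (subst set_integral_diff) (auto intro!: set_integrable_mult_right set_integrable_beta_weight_poly \<nu> continuous_intros)
  ultimately show ?thesis by simp
qed

lemma beta_moment_eq_cos_moment:
  assumes \<nu>: "\<nu> > -1/2"
  shows "beta_moment \<nu> k = cos_moment (\<nu> + 1) k"
proof (induction k rule: induct_nat_012)
  case 0
  then show ?case
    using integral_beta_weight[OF \<nu>] by (simp add: beta_moment_def cos_moment_def)
next
  case 1
  then show ?case
    using beta_moment_rec[OF \<nu>, of 0] \<nu> by (simp add: cos_moment_def)
next
  case (ge2 k)
  have "real (Suc k) * beta_moment \<nu> k = (real (Suc k) + 2 * \<nu> + 1) * beta_moment \<nu> (Suc (Suc k))"
    using beta_moment_rec[OF \<nu>, of "Suc k"] by simp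
  moreover have "real (Suc k) * cos_moment (\<nu> + 1) k = (real (Suc k) + 2 * \<nu> + 1) * cos_moment (\<nu> + 1) (Suc (Suc k))"
  proof (cases "even k")
    case True
    then obtain j where j: "k = 2 * j" by (elim evenE)
    have "\<nu> + 1 + real j \<noteq> 0" "pochhammer (\<nu> + 1) j \<noteq> 0"
      using \<nu> pochhammer_pos[of "\<nu> + 1" j] by auto
    then show ?thesis
      by (simp add: cos_moment_def j pochhammer_Suc divide_simps) (simp add: algebra_simps)
  qed (simp add: cos_moment_def)
  ultimately show ?case
    using \<nu> ge2(1) by simp
qed

text \<open>Heron's formula: with \<open>t = (z\<^sup>2 - (x - y)\<^sup>2) / (4 x y)\<close> the area \<open>\<Delta>\<close> equals \<open>x y sqrt (t (1 - t))\<close>. The last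
  factor is \<open>dt / dz\<close>.\<close>
lemma bessel_W_change_of_variables:
  assumes x: "x > 0" and y: "y > 0" and z: "z \<in> {\<bar>x - y\<bar>..x + y}"
  shows "bessel_W \<nu> x y z * z powr (2 * \<nu> + 1)
       = beta_weight \<nu> ((z\<^sup>2 - (x - y)\<^sup>2) / (4 * x * y)) * (z / (2 * x * y))"
\<comment> \<open>At \<open>z = 0\<close>, which occurs only for \<open>x = y\<close>, both sides are \<open>0\<close>, the left one because \<open>0 powr a = 0\<close>.\<close>
proof (cases "z = 0")
  case False
  with z have zpos: "z > 0" by auto
  define t where "t = (z\<^sup>2 - (x - y)\<^sup>2) / (4 * x * y)"
  have sq: "z\<^sup>2 \<ge> (x - y)\<^sup>2" "z\<^sup>2 \<le> (x + y)\<^sup>2"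
    using z zpos x y by (auto simp: abs_le_square_iff[symmetric])
  have t1: "1 - t = ((x + y)\<^sup>2 - z\<^sup>2) / (4 * x * y)"
    using x y by (simp add: t_def field_simps power2_eq_square)
  have t: "t \<ge> 0" "1 - t \<ge> 0"
    using sq x y unfolding t1 by (auto simp: t_def)
  have "(x + y + z) * (x + y - z) * (x - y + z) * (y + z - x) = ((x + y)\<^sup>2 - z\<^sup>2) * (z\<^sup>2 - (x - y)\<^sup>2)"
    by (simp add: algebra_simps power2_eq_square)
  also have "\<dots> = (4 * (x * y))\<^sup>2 * (t * (1 - t))"
    unfolding t1 using x y by (simp add: t_def field_simps power2_eq_square)
  finally have "bessel_Delta x y z = x * y * sqrt (t * (1 - t))"
    using x y by (simp add: bessel_Delta_def real_sqrt_mult)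
  then have "bessel_Delta x y z powr (2 * \<nu> - 1) = (x * y) powr (2 * \<nu> - 1) * sqrt (t * (1 - t)) powr (2 * \<nu> - 1)"
    using x y t by (simp add: powr_mult)
  also have "sqrt (t * (1 - t)) powr (2 * \<nu> - 1) = (t * (1 - t)) powr (\<nu> - 1/2)"
    using t by (simp add: powr_powr diff_divide_distrib flip: powr_half_sqrt)
  also have "(x * y) powr (2 * \<nu> - 1) = (x * y) powr (2 * \<nu>) / (x * y)"
    using x y by (simp add: powr_diff)
  finally have D: "bessel_Delta x y z powr (2 * \<nu> - 1) = (x * y) powr (2 * \<nu>) / (x * y) * (t * (1 - t)) powr (\<nu> - 1/2)" .
  have "(2::real) powr (2 * \<nu>) = 4 powr \<nu>"
    using powr_powr[of 2 2 \<nu>] by simp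
  then have four: "(2::real) powr (2 * \<nu> - 1) = 4 powr \<nu> / 2"
    by (simp add: powr_diff)
  have xyz: "(x * y * z) powr (2 * \<nu>) = (x * y) powr (2 * \<nu>) * z powr (2 * \<nu>)"
    using x y zpos by (simp add: powr_mult)
  have zp: "z powr (2 * \<nu> + 1) = z powr (2 * \<nu>) * z"
    using zpos by (simp add: powr_add)
  have "(x * y) powr (2 * \<nu>) > 0" "z powr (2 * \<nu>) > 0"
    using x y zpos by auto
  then show ?thesis
    unfolding bessel_W_def D xyz zp four beta_weight_def t_def[symmetric]
    using z x y by (simp add: divide_simps)
qed simp

text \<open>The substitution \<open>t = (z\<^sup>2 - (x - y)\<^sup>2) / (4 x y)\<close> maps \<open>[\<bar>x - y\<bar>, x + y]\<close> increasingly onto \<open>[0, 1]\<close>.\<close>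
lemma
  assumes \<nu>: "\<nu> > -1/2" and x: "x > 0" and y: "y > 0"
    and cont: "continuous_on UNIV \<phi>"
  shows integrable_bessel_W: "integrable lborel (\<lambda>z. \<phi> (z\<^sup>2) * (bessel_W \<nu> x y z * z powr (2 * \<nu> + 1)))"
    and integral_bessel_W: "(LINT z|lborel. \<phi> (z\<^sup>2) * (bessel_W \<nu> x y z * z powr (2 * \<nu> + 1)))
        = (LINT t:{0..1}|lborel. \<phi> (x\<^sup>2 + y\<^sup>2 + 2 * x * y * (2 * t - 1)) * beta_weight \<nu> t)"
proof -
  let ?g = "\<lambda>z. (z\<^sup>2 - (x - y)\<^sup>2) / (4 * x * y)" and ?g' = "\<lambda>z. z / (2 * x * y)"
  let ?f = "\<lambda>t. \<phi> (x\<^sup>2 + y\<^sup>2 + 2 * x * y * (2 * t - 1)) * beta_weight \<nu> t"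
  let ?a = "\<bar>x - y\<bar>" and ?b = "x + y"
  have ga: "?g ?a = 0" and gb: "?g ?b = 1"
    using x y by (simp_all add: field_simps power2_eq_square)
  have inv: "x\<^sup>2 + y\<^sup>2 + 2 * x * y * (2 * ?g z - 1) = z\<^sup>2" for z
    using x y by (simp add: field_simps power2_eq_square)
  have f: "set_integrable lborel {?g ?a..?g ?b} ?f"
    unfolding ga gb by (intro set_integrable_beta_weight_poly \<nu> continuous_intros continuous_on_compose2[OF cont]) auto
  have der: "(?g has_real_derivative ?g' z) (at z)" for z
    using x y by (auto intro!: derivative_eq_intros)
  have cont': "continuous_on {?a..?b} ?g'"
    by (intro continuous_intros) (use x y in auto)
  have nonneg: "?g' z \<ge> 0" if "z \<in> {?a..?b}" for z
    using that x y by auto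
  have le: "?a \<le> ?b" using x y by auto
  note sub = integral_substitution[OF f der cont' nonneg le]
  have eq: "?f (?g z) * ?g' z * indicator {?a..?b} z = \<phi> (z\<^sup>2) * (bessel_W \<nu> x y z * z powr (2 * \<nu> + 1))" for z
  proof (cases "z \<in> {?a..?b}")
    case True
    then show ?thesis
      unfolding inv bessel_W_change_of_variables[OF x y True] by simp
  qed (simp add: bessel_W_def)
  show "integrable lborel (\<lambda>z. \<phi> (z\<^sup>2) * (bessel_W \<nu> x y z * z powr (2 * \<nu> + 1)))"
    using sub(1) unfolding set_integrable_def eq[symmetric] by (simp add: mult_ac)
  show "(LINT z|lborel. \<phi> (z\<^sup>2) * (bessel_W \<nu> x y z * z powr (2 * \<nu> + 1))) = (LINT t:{0..1}|lborel. ?f t)"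
    using sub(2) unfolding eq ga gb by (simp add: set_lebesgue_integral_def mult_ac)
qed

lemma integral_even_power_bessel_W:
  assumes \<nu>: "\<nu> > -1/2" and x: "x > 0" and y: "y > 0"
  shows "(LINT z|lborel. z ^ (2 * n) * (bessel_W \<nu> x y z * z powr (2 * \<nu> + 1)))
     = fact n * pochhammer (\<nu> + 1) n * fps_nth (bessel_fps (\<nu> + 1) (x\<^sup>2) * bessel_fps (\<nu> + 1) (y\<^sup>2)) n"
proof -
  have int: "set_integrable lborel {0..1} (\<lambda>t. real (n choose m) * (2 * (x * y)) ^ m * (x\<^sup>2 + y\<^sup>2) ^ (n - m)
        * ((2 * t - 1) ^ m * beta_weight \<nu> t))" for m
    by (intro set_integrable_mult_right set_integrable_beta_weight_poly \<nu> continuous_intros)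
  have "(LINT z|lborel. z ^ (2 * n) * (bessel_W \<nu> x y z * z powr (2 * \<nu> + 1)))
      = (LINT t:{0..1}|lborel. (x\<^sup>2 + y\<^sup>2 + 2 * x * y * (2 * t - 1)) ^ n * beta_weight \<nu> t)"
    using integral_bessel_W[OF \<nu> x y, of "\<lambda>v. v ^ n"] by (simp add: power_mult continuous_intros)
  also have "\<dots> = (LINT t:{0..1}|lborel. \<Sum>m\<le>n. real (n choose m) * (2 * (x * y)) ^ m * (x\<^sup>2 + y\<^sup>2) ^ (n - m)
        * ((2 * t - 1) ^ m * beta_weight \<nu> t))"
  proof (intro set_lebesgue_integral_cong ballI allI impI)
    fix t :: real
    have "(x\<^sup>2 + y\<^sup>2 + 2 * x * y * (2 * t - 1)) ^ n = (2 * (x * y) * (2 * t - 1) + (x\<^sup>2 + y\<^sup>2)) ^ n"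
      by (simp add: algebra_simps)
    also have "\<dots> = (\<Sum>m\<le>n. real (n choose m) * (2 * (x * y)) ^ m * (x\<^sup>2 + y\<^sup>2) ^ (n - m) * (2 * t - 1) ^ m)"
      by (subst binomial_ring, subst power_mult_distrib[of "2 * (x * y)" "2 * t - 1"]) (simp only: mult_ac)
    finally show "(x\<^sup>2 + y\<^sup>2 + 2 * x * y * (2 * t - 1)) ^ n * beta_weight \<nu> t = (\<Sum>m\<le>n. real (n choose m) * (2 * (x * y)) ^ m
        * (x\<^sup>2 + y\<^sup>2) ^ (n - m) * ((2 * t - 1) ^ m * beta_weight \<nu> t))"
      by (simp add: sum_distrib_right mult.assoc)
  qed simp
  also have "\<dots> = (\<Sum>m\<le>n. real (n choose m) * (2 * (x * y)) ^ m * (x\<^sup>2 + y\<^sup>2) ^ (n - m) * beta_moment \<nu> m)"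
    unfolding beta_moment_def set_integral_mult_right[symmetric] unfolding set_lebesgue_integral_def scaleR_sum_right
    using int unfolding set_integrable_def by (intro Bochner_Integration.integral_sum)
  also have "\<dots> = fact n * pochhammer (\<nu> + 1) n * fps_nth (bessel_fps (\<nu> + 1) (x\<^sup>2) * bessel_fps (\<nu> + 1) (y\<^sup>2)) n"
    unfolding beta_moment_eq_cos_moment[OF \<nu>]
    using \<nu> by (intro cos_moment_binomial_sum) (auto simp: power_mult_distrib)
  finally show ?thesis .
qed

lemma bessel_W_nonneg: "\<nu> > -1/2 \<Longrightarrow> bessel_W \<nu> x y z \<ge> 0"
  by (auto simp: bessel_W_def intro!: mult_nonneg_nonneg divide_nonneg_nonneg Gamma_real_nonneg)

lemma nn_integral_even_power_bessel_density:
  assumes \<nu>: "\<nu> > -1/2" and x: "x > 0" and y: "y > 0"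
  shows "(\<integral>\<^sup>+z. ennreal (z ^ (2 * n) * (bessel_W \<nu> x y z * z powr (2 * \<nu> + 1))) \<partial>lborel)
     = ennreal (fact n * pochhammer (\<nu> + 1) n * fps_nth (bessel_fps (\<nu> + 1) (x\<^sup>2) * bessel_fps (\<nu> + 1) (y\<^sup>2)) n)"
proof -
  have "integrable lborel (\<lambda>z. z ^ (2 * n) * (bessel_W \<nu> x y z * z powr (2 * \<nu> + 1)))"
    using integrable_bessel_W[OF \<nu> x y, of "\<lambda>v. v ^ n"] by (simp add: power_mult continuous_intros)
  then show ?thesis
    unfolding integral_even_power_bessel_W[OF \<nu> x y, symmetric]
    by (intro nn_integral_eq_integral) (auto intro!: mult_nonneg_nonneg bessel_W_nonneg \<nu>)
qed

section \<open>Determination of a density by its even moments\<close>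

text \<open>By Taylor's formula the characteristic function at \<open>t\<close> differs from its \<open>n\<close>-th Taylor polynomial, which
  depends on the moments only, by at most \<open>2 (\<bar>t\<bar> R)\<^bsup>n\<^esup> / n!\<close>.\<close>
lemma moments_determine_distribution:
  assumes M: "real_distribution M" and N: "real_distribution N"
    and bM: "AE x in M. \<bar>x\<bar> \<le> R" and bN: "AE x in N. \<bar>x\<bar> \<le> R"
    and eq: "\<And>n. (\<integral>x. x ^ n \<partial>M) = (\<integral>x. x ^ n \<partial>N)"
  shows "M = N"
proof (rule Levy_uniqueness[OF M N], rule ext)
  fix t :: real
  define S where "S n = (\<Sum>k\<le>n. ((\<i> * t) ^ k / fact k) * (\<integral>x. x ^ k \<partial>M))" for n
  have approx: "cmod (char D t - (\<Sum>k\<le>n. ((\<i> * t) ^ k / fact k) * (\<integral>x. x ^ k \<partial>D)))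
      \<le> 2 * (inverse (fact n) * (\<bar>t\<bar> * R) ^ n)"
    if D: "real_distribution D" and b: "AE x in D. \<bar>x\<bar> \<le> R" for D n
  proof -
    interpret real_distribution D by (rule D)
    have bn: "AE x in D. \<bar>x\<bar> ^ k \<le> R ^ k" for k
      using b by eventually_elim (auto intro: power_mono)
    have int: "integrable D (\<lambda>x. x ^ k)" for k
      using bn[of k] by (intro integrable_const_bound[where B = "R ^ k"]) (auto simp: power_abs)
    have "integrable D (\<lambda>x. \<bar>x\<bar> ^ n)"
      using int[of n] by (simp flip: power_abs)
    then have "expectation (\<lambda>x. \<bar>x\<bar> ^ n) \<le> R ^ n"
      using bn[of n] by (intro integral_le_const)
    then have "(2 * \<bar>t\<bar> ^ n / fact n) * expectation (\<lambda>x. \<bar>x\<bar> ^ n) \<le> (2 * \<bar>t\<bar> ^ n / fact n) * R ^ n"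
      by (intro mult_left_mono) auto
    with char_approx1[of n t, OF int]
    have "cmod (char D t - (\<Sum>k\<le>n. ((\<i> * t) ^ k / fact k) * (\<integral>x. x ^ k \<partial>D)))
        \<le> (2 * \<bar>t\<bar> ^ n / fact n) * R ^ n"
      by (rule order_trans)
    also have "\<dots> = 2 * (inverse (fact n) * (\<bar>t\<bar> * R) ^ n)"
      by (simp add: power_mult_distrib divide_inverse mult_ac)
    finally show ?thesis .
  qed
  have lim: "(\<lambda>n. 2 * (inverse (fact n) * (\<bar>t\<bar> * R) ^ n)) \<longlonglongrightarrow> 0"
    using tendsto_mult_right_zero[OF summable_LIMSEQ_zero[OF summable_exp[of "\<bar>t\<bar> * R"]], of 2] by simp
  \<comment> \<open>Both characteristic functions are limits of the same Taylor polynomials.\<close>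
  have "(\<lambda>n. char M t - S n) \<longlonglongrightarrow> 0"
    using approx[OF M bM] unfolding S_def
    by (intro Lim_null_comparison[OF _ lim]) (auto intro!: always_eventually)
  moreover have "(\<lambda>n. char N t - S n) \<longlonglongrightarrow> 0"
    using approx[OF N bN] unfolding S_def eq
    by (intro Lim_null_comparison[OF _ lim]) (auto intro!: always_eventually)
  ultimately have "(\<lambda>n. (char M t - S n) - (char N t - S n)) \<longlonglongrightarrow> 0 - 0"
    by (rule tendsto_diff)
  then show "char M t = char N t"
    by (simp add: tendsto_const_iff)
qed

text \<open>Even moments are the moments of \<open>z\<^sup>2\<close>, so they determine the law of \<open>z\<^sup>2\<close>; on the support, which lies in
  \<open>[0, R]\<close>, the square root recovers \<open>z\<close>.\<close>
lemma densities_eq_of_even_moments_eq: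
  fixes k l :: "real \<Rightarrow> ennreal"
  assumes [measurable]: "k \<in> borel_measurable lborel" "l \<in> borel_measurable lborel"
    and supp: "\<And>z. z < 0 \<or> z > R \<Longrightarrow> k z = 0" "\<And>z. z < 0 \<or> z > R \<Longrightarrow> l z = 0"
    and one: "(\<integral>\<^sup>+z. k z \<partial>lborel) = 1"
    and eq: "\<And>n. (\<integral>\<^sup>+z. k z * ennreal (z ^ (2 * n)) \<partial>lborel) = (\<integral>\<^sup>+z. l z * ennreal (z ^ (2 * n)) \<partial>lborel)"
  shows "AE z in lborel. k z = l z"
proof -
  let ?sq = "\<lambda>j. distr (density lborel j) borel (\<lambda>z. z\<^sup>2)"
  have distribution: "real_distribution (?sq j)"
    if [measurable]: "j \<in> borel_measurable lborel" and 1: "(\<integral>\<^sup>+z. j z \<partial>lborel) = 1" for j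
  proof -
    interpret prob_space "density lborel j"
      by standard (simp add: emeasure_density 1)
    show ?thesis by (rule real_distribution_distr) simp
  qed
  have bound: "AE v in ?sq j. \<bar>v\<bar> \<le> R\<^sup>2"
    if [measurable]: "j \<in> borel_measurable lborel" and supp: "\<And>z. z < 0 \<or> z > R \<Longrightarrow> j z = 0" for j
  proof -
    have "z\<^sup>2 \<le> R\<^sup>2" if "0 < j z" for z
      using supp[of z] that by (intro power_mono) force+
    then show ?thesis
      by (simp add: AE_distr_iff AE_density)
  qed
  have moment: "(\<integral>v. v ^ n \<partial>?sq j) = enn2real (\<integral>\<^sup>+z. j z * ennreal (z ^ (2 * n)) \<partial>lborel)"
    if [measurable]: "j \<in> borel_measurable lborel" for j n
    by (simp add: integral_distr integral_eq_nn_integral nn_integral_density flip: power_mult)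
  have "?sq k = ?sq l"
    using one eq[of 0] supp
    by (intro moments_determine_distribution[of _ _ "R\<^sup>2"] distribution bound) (auto simp: moment eq)
  then have "distr (?sq k) borel sqrt = distr (?sq l) borel sqrt" by simp
  moreover have "distr (?sq j) borel sqrt = density lborel j"
    if [measurable]: "j \<in> borel_measurable lborel" and supp: "\<And>z. z < 0 \<or> z > R \<Longrightarrow> j z = 0" for j
  proof -
    have "\<bar>z\<bar> = z" if "0 < j z" for z
      using supp[of z] that by force
    then have "AE z in density lborel j. \<bar>z\<bar> = z"
      by (simp add: AE_density)
    then have "distr (density lborel j) borel (\<lambda>z. \<bar>z\<bar>) = distr (density lborel j) (density lborel j) (\<lambda>z. z)"
      by (intro distr_cong_AE) auto
    then show ?thesis by (simp add: distr_distr comp_def)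
  qed
  ultimately have "density lborel k = density lborel l"
    using supp by simp
  then show ?thesis
    by (intro sigma_finite_measure.density_unique[OF sigma_finite_lborel]) auto
qed

section \<open>The half line\<close>

lemma nn_integral_half_line:
  "(\<integral>\<^sup>+x. f x \<partial>half_line) = (\<integral>\<^sup>+x. f x * indicator {0..} x \<partial>lborel)"
  by (simp add: nn_integral_restrict_space nn_integral_completion)

lemma AE_half_line: "(AE x in lborel. x > 0 \<longrightarrow> P x) \<Longrightarrow> (AE x in half_line. P x)"
proof -
  assume "AE x in lborel. x > 0 \<longrightarrow> P x"
  then have "AE x in lborel. 0 \<le> x \<longrightarrow> P x"
    using AE_lborel_singleton[of "0::real"] by eventually_elim auto
  then show ?thesis
    by (simp add: AE_restrict_space_iff AE_completion)
qed

lemma AE_half_line_pos: "AE x in half_line. x > 0"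
  by (rule AE_half_line) simp

lemma sigma_finite_completion:
  assumes "sigma_finite_measure M"
  shows "sigma_finite_measure (completion M)"
proof -
  obtain A where A: "countable A" "A \<subseteq> sets M" "\<Union>A = space M" "\<forall>a\<in>A. emeasure M a \<noteq> \<infinity>"
    using sigma_finite_measure.sigma_finite_countable[OF assms] by blast
  then show ?thesis
    by unfold_locales (intro exI[of _ A], auto)
qed

lemma sigma_finite_half_line: "sigma_finite_measure half_line"
  by (intro sigma_finite_measure_restrict_space sigma_finite_completion sigma_finite_lborel) auto

lemma borel_measurable_ident_half_line: "(\<lambda>s. s) \<in> borel_measurable half_line"
  using id_borel_measurable_lebesgue_on[of "{0..}"] by (simp add: id_def)

text \<open>The \<open>\<sigma>\<close>-algebra of \<open>half_line\<close> consists of Lebesgue sets, so a coordinate on a product of half lines is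
  Borel measurable only by composition with the identity. A general rule for that composition would
  apply to every goal; these are the instances that occur.\<close>
lemma borel_measurable_coordinate_half_line [measurable (raw)]:
  "(\<lambda>s. s) \<in> borel_measurable half_line"
  "(\<lambda>p. fst p) \<in> borel_measurable (half_line \<Otimes>\<^sub>M N)"
  "(\<lambda>p. snd p) \<in> borel_measurable (N \<Otimes>\<^sub>M half_line)"
  "(\<lambda>p. fst (fst p)) \<in> borel_measurable ((half_line \<Otimes>\<^sub>M N) \<Otimes>\<^sub>M P)"
  "(\<lambda>p. snd (fst p)) \<in> borel_measurable ((N \<Otimes>\<^sub>M half_line) \<Otimes>\<^sub>M P)"
  "(\<lambda>p. fst (fst (fst p))) \<in> borel_measurable (((half_line \<Otimes>\<^sub>M N) \<Otimes>\<^sub>M P) \<Otimes>\<^sub>M Q)"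
  "(\<lambda>p. snd (fst (fst p))) \<in> borel_measurable (((N \<Otimes>\<^sub>M half_line) \<Otimes>\<^sub>M P) \<Otimes>\<^sub>M Q)"
  by (rule measurable_compose[where g = "\<lambda>s. s", OF _ borel_measurable_ident_half_line]; measurable)+

section \<open>Associativity of the translation kernel\<close>

lemma bessel_W_commute: "bessel_W \<nu> x y z = bessel_W \<nu> y x z"
proof -
  have "bessel_Delta x y z = bessel_Delta y x z"
    unfolding bessel_Delta_def by (simp add: algebra_simps)
  then show ?thesis
    by (simp add: bessel_W_def abs_minus_commute add.commute mult_ac)
qed

lemma bessel_W_eq_0: "z < \<bar>x - y\<bar> \<or> x + y < z \<Longrightarrow> bessel_W \<nu> x y z = 0"
  by (auto simp: bessel_W_def)

lemma borel_measurable_bessel_W [measurable (raw)]: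
  assumes [measurable]: "f \<in> borel_measurable M" "g \<in> borel_measurable M" "h \<in> borel_measurable M"
  shows "(\<lambda>p. bessel_W \<nu> (f p) (g p) (h p)) \<in> borel_measurable M"
proof -
  have "(\<lambda>p. bessel_W \<nu> (f p) (g p) (h p)) = (\<lambda>p. 2 powr (2 * \<nu> - 1) * Gamma (\<nu> + 1) / (sqrt pi * Gamma (\<nu> + 1/2))
     * (bessel_Delta (f p) (g p) (h p) powr (2 * \<nu> - 1) / (f p * g p * h p) powr (2 * \<nu>))
     * (if \<bar>f p - g p\<bar> \<le> h p \<and> h p \<le> f p + g p then 1 else 0))"
    by (auto simp: bessel_W_def fun_eq_iff indicator_def)
  also have "\<dots> \<in> borel_measurable M"
    unfolding bessel_Delta_def by measurable
  finally show ?thesis .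
qed

lemma bessel_W_rotate:
  assumes "x > 0" "y > 0" "z > 0"
  shows "bessel_W \<nu> x y z = bessel_W \<nu> x z y"
proof -
  have "bessel_Delta x y z = bessel_Delta x z y"
    unfolding bessel_Delta_def by (simp add: algebra_simps)
  moreover have "indicator {\<bar>x - y\<bar>..x + y} z = (indicator {\<bar>x - z\<bar>..x + z} y :: real)"
    using assms by (auto simp: indicator_def)
  ultimately show ?thesis
    by (simp add: bessel_W_def mult_ac)
qed

text \<open>The inner integral is a polynomial in \<open>s\<^sup>2\<close>, so the outer one is a combination of even moments, and the
  combination is that of the product of three power series.\<close>
lemma nn_integral_even_power_bessel_density_twice:
  assumes \<nu>: "\<nu> > -1/2" and x: "x > 0" and y: "y > 0" and t: "t > 0"
  shows "(\<integral>\<^sup>+s. ennreal (bessel_W \<nu> x y s * s powr (2 * \<nu> + 1)) *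
            (\<integral>\<^sup>+z. ennreal (z ^ (2 * n) * (bessel_W \<nu> s t z * z powr (2 * \<nu> + 1))) \<partial>lborel) \<partial>lborel)
     = ennreal (fact n * pochhammer (\<nu> + 1) n *
          fps_nth (bessel_fps (\<nu> + 1) (x\<^sup>2) * bessel_fps (\<nu> + 1) (y\<^sup>2) * bessel_fps (\<nu> + 1) (t\<^sup>2)) n)"
proof -
  let ?c = "\<nu> + 1"
  let ?C = "fact n * pochhammer ?c n"
  define b where "b i = ?C * fps_nth (bessel_fps ?c (t\<^sup>2)) (n - i) / (fact i * pochhammer ?c i)" for i
  have c: "?c > 0" using \<nu> by simp
  have poch: "pochhammer ?c i > 0" for i using c by (rule pochhammer_pos)
  have b: "b i \<ge> 0" for i
    using poch t by (auto simp: b_def bessel_fps_def intro!: mult_nonneg_nonneg divide_nonneg_nonneg less_imp_le[OF poch])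
  have inner: "?C * fps_nth (bessel_fps ?c (s\<^sup>2) * bessel_fps ?c (t\<^sup>2)) n = (\<Sum>i\<le>n. b i * s ^ (2 * i))" for s
    by (simp add: b_def bessel_fps_def fps_mult_nth sum_distrib_left atMost_atLeast0 mult_ac flip: power_mult)
  have "(\<integral>\<^sup>+s. ennreal (bessel_W \<nu> x y s * s powr (2 * \<nu> + 1)) *
            (\<integral>\<^sup>+z. ennreal (z ^ (2 * n) * (bessel_W \<nu> s t z * z powr (2 * \<nu> + 1))) \<partial>lborel) \<partial>lborel)
      = (\<integral>\<^sup>+s. (\<Sum>i\<le>n. ennreal (b i) * ennreal (s ^ (2 * i) * (bessel_W \<nu> x y s * s powr (2 * \<nu> + 1)))) \<partial>lborel)"
  proof (rule nn_integral_cong_AE, use AE_lborel_singleton[of 0] in eventually_elim)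
    fix s :: real assume "s \<noteq> 0"
    show "ennreal (bessel_W \<nu> x y s * s powr (2 * \<nu> + 1)) *
            (\<integral>\<^sup>+z. ennreal (z ^ (2 * n) * (bessel_W \<nu> s t z * z powr (2 * \<nu> + 1))) \<partial>lborel)
        = (\<Sum>i\<le>n. ennreal (b i) * ennreal (s ^ (2 * i) * (bessel_W \<nu> x y s * s powr (2 * \<nu> + 1))))"
    proof (cases "s > 0")
      case True
      have "ennreal (bessel_W \<nu> x y s * s powr (2 * \<nu> + 1)) * ennreal (\<Sum>i\<le>n. b i * s ^ (2 * i))
          = ennreal (\<Sum>i\<le>n. b i * (s ^ (2 * i) * (bessel_W \<nu> x y s * s powr (2 * \<nu> + 1))))"
        using bessel_W_nonneg[OF \<nu>] b True
        by (subst ennreal_mult[symmetric]) (auto intro!: sum_nonneg simp: sum_distrib_left sum_distrib_right mult_ac)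
      also have "\<dots> = (\<Sum>i\<le>n. ennreal (b i) * ennreal (s ^ (2 * i) * (bessel_W \<nu> x y s * s powr (2 * \<nu> + 1))))"
        using bessel_W_nonneg[OF \<nu>] b True by (simp add: ennreal_mult flip: sum_ennreal)
      finally show ?thesis
        unfolding nn_integral_even_power_bessel_density[OF \<nu> True t] inner .
    next
      case False
      with \<open>s \<noteq> 0\<close> have "bessel_W \<nu> x y s = 0" by (intro bessel_W_eq_0) auto
      then show ?thesis by simp
    qed
  qed
  also have "\<dots> = (\<Sum>i\<le>n. ennreal (b i) * (\<integral>\<^sup>+s. ennreal (s ^ (2 * i) * (bessel_W \<nu> x y s * s powr (2 * \<nu> + 1))) \<partial>lborel))"
    by (simp add: nn_integral_sum nn_integral_cmult)
  also have "\<dots> = (\<Sum>i\<le>n. ennreal (b i * (fact i * pochhammer ?c i * fps_nth (bessel_fps ?c (x\<^sup>2) * bessel_fps ?c (y\<^sup>2)) i)))"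
    unfolding nn_integral_even_power_bessel_density[OF \<nu> x y] using b by (simp add: ennreal_mult')
  also have "\<dots> = (\<Sum>i\<le>n. ennreal (?C * (fps_nth (bessel_fps ?c (x\<^sup>2) * bessel_fps ?c (y\<^sup>2)) i * fps_nth (bessel_fps ?c (t\<^sup>2)) (n - i))))"
    using poch by (intro sum.cong refl arg_cong[of _ _ ennreal]) (simp add: b_def less_imp_neq[THEN not_sym])
  also have "\<dots> = ennreal (\<Sum>i\<le>n. ?C * (fps_nth (bessel_fps ?c (x\<^sup>2) * bessel_fps ?c (y\<^sup>2)) i * fps_nth (bessel_fps ?c (t\<^sup>2)) (n - i)))"
    by (intro sum_ennreal mult_nonneg_nonneg)
       (auto simp: bessel_fps_def fps_mult_nth less_imp_le[OF poch] intro!: sum_nonneg divide_nonneg_nonneg mult_nonneg_nonneg)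
  also have "(\<Sum>i\<le>n. ?C * (fps_nth (bessel_fps ?c (x\<^sup>2) * bessel_fps ?c (y\<^sup>2)) i * fps_nth (bessel_fps ?c (t\<^sup>2)) (n - i)))
      = ?C * fps_nth (bessel_fps ?c (x\<^sup>2) * bessel_fps ?c (y\<^sup>2) * bessel_fps ?c (t\<^sup>2)) n"
    by (simp add: fps_mult_nth[of _ "bessel_fps ?c (t\<^sup>2)"] sum_distrib_left atMost_atLeast0)
  finally show ?thesis .
qed

text \<open>By Tonelli this is an iterated even moment of the densities of \<open>W x y\<close> and \<open>W s t\<close>.\<close>
lemma nn_integral_even_power_bessel_kernel:
  assumes \<nu>: "\<nu> > -1/2" and x: "x > 0" and y: "y > 0" and t: "t > 0"
  shows "(\<integral>\<^sup>+z. ennreal (z powr (2 * \<nu> + 1)) *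
            (\<integral>\<^sup>+s. ennreal (bessel_W \<nu> x y s * bessel_W \<nu> s t z * s powr (2 * \<nu> + 1)) \<partial>lborel)
            * ennreal (z ^ (2 * n)) \<partial>lborel)
     = ennreal (fact n * pochhammer (\<nu> + 1) n *
          fps_nth (bessel_fps (\<nu> + 1) (x\<^sup>2) * bessel_fps (\<nu> + 1) (y\<^sup>2) * bessel_fps (\<nu> + 1) (t\<^sup>2)) n)"
proof -
  note W = bessel_W_nonneg[OF \<nu>]
  have pow: "0 \<le> z ^ (n * 2)" for z :: real
    by (simp add: power_mult)
  have "(\<integral>\<^sup>+z. ennreal (z powr (2 * \<nu> + 1)) *
            (\<integral>\<^sup>+s. ennreal (bessel_W \<nu> x y s * bessel_W \<nu> s t z * s powr (2 * \<nu> + 1)) \<partial>lborel)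
            * ennreal (z ^ (2 * n)) \<partial>lborel)
     = (\<integral>\<^sup>+z. \<integral>\<^sup>+s. ennreal (bessel_W \<nu> x y s * s powr (2 * \<nu> + 1)) *
            ennreal (z ^ (2 * n) * (bessel_W \<nu> s t z * z powr (2 * \<nu> + 1))) \<partial>lborel \<partial>lborel)"
    by (subst nn_integral_cmult[symmetric], simp, subst nn_integral_multc[symmetric], simp)
       (intro nn_integral_cong, simp add: W pow mult_ac flip: ennreal_mult)
  also have "\<dots> = (\<integral>\<^sup>+s. \<integral>\<^sup>+z. ennreal (bessel_W \<nu> x y s * s powr (2 * \<nu> + 1)) *
            ennreal (z ^ (2 * n) * (bessel_W \<nu> s t z * z powr (2 * \<nu> + 1))) \<partial>lborel \<partial>lborel)"
    by (rule lborel_pair.Fubini') measurable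
  also have "\<dots> = (\<integral>\<^sup>+s. ennreal (bessel_W \<nu> x y s * s powr (2 * \<nu> + 1)) *
            (\<integral>\<^sup>+z. ennreal (z ^ (2 * n) * (bessel_W \<nu> s t z * z powr (2 * \<nu> + 1))) \<partial>lborel) \<partial>lborel)"
    by (simp add: nn_integral_cmult)
  finally show ?thesis
    using nn_integral_even_power_bessel_density_twice[OF assms] by simp
qed

text \<open>In terms of the product of measures for which \<open>\<delta>\<^sub>x \<cdot> \<delta>\<^sub>y\<close> has density \<open>W x y\<close> with respect to
  \<open>z\<^bsup>2\<nu>+1\<^esup> dz\<close>, this is the density of \<open>(\<delta>\<^sub>x \<cdot> \<delta>\<^sub>y) \<cdot> \<delta>\<^sub>t\<close>.\<close>
definition bessel_kernel :: "real \<Rightarrow> real \<Rightarrow> real \<Rightarrow> real \<Rightarrow> real \<Rightarrow> real" where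
  "bessel_kernel \<nu> x y t z =
     (LINT s|half_line. bessel_W \<nu> x y s * bessel_W \<nu> s t z * s powr (2 * \<nu> + 1))"

text \<open>Associativity of the product of point masses. Both sides have the same even moments, given by a
  product of three power series, and are supported in \<open>[0, x + y + t]\<close>.\<close>
lemma bessel_kernel_cyclic:
  assumes \<nu>: "\<nu> > -1/2" and x: "x > 0" and y: "y > 0" and t: "t > 0"
  shows "AE z in half_line. bessel_kernel \<nu> x y t z = bessel_kernel \<nu> y t x z"
proof -
  \<comment> \<open>For \<open>\<nu> \<le> 0\<close> the integral can be infinite for exceptional \<open>z\<close>, hence values in \<open>[0, \<infinity>]\<close>; the Bochner integral is its
  \<open>enn2real\<close> in every case.\<close>
  define K where "K x y t z = (\<integral>\<^sup>+s. ennreal (bessel_W \<nu> x y s * bessel_W \<nu> s t z * s powr (2 * \<nu> + 1)) \<partial>lborel)" for x y t z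
  have K_meas [measurable]: "K x y t \<in> borel_measurable lborel" for x y t
    unfolding K_def by measurable
  note moments = nn_integral_even_power_bessel_kernel[OF \<nu>, folded K_def]
  have K_0: "K x y t z = 0" if "x > 0" "y > 0" "t > 0" "z < 0 \<or> z > x + y + t" for x y t z
  proof -
    have "bessel_W \<nu> x y s * bessel_W \<nu> s t z = 0" for s
      using that by (cases "s > x + y") (auto intro!: bessel_W_eq_0)
    then show ?thesis unfolding K_def by (simp only: mult_zero_left ennreal_0 nn_integral_const)
  qed
  have "AE z in lborel. ennreal (z powr (2 * \<nu> + 1)) * K x y t z = ennreal (z powr (2 * \<nu> + 1)) * K y t x z"
  proof (rule densities_eq_of_even_moments_eq[where R = "x + y + t"])
    show "(\<integral>\<^sup>+z. ennreal (z powr (2 * \<nu> + 1)) * K x y t z \<partial>lborel) = 1"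
      using moments[OF x y t, of 0] by (simp add: bessel_fps_def)
  next
    fix n
    show "(\<integral>\<^sup>+z. ennreal (z powr (2 * \<nu> + 1)) * K x y t z * ennreal (z ^ (2 * n)) \<partial>lborel)
        = (\<integral>\<^sup>+z. ennreal (z powr (2 * \<nu> + 1)) * K y t x z * ennreal (z ^ (2 * n)) \<partial>lborel)"
      unfolding moments[OF x y t] moments[OF y t x] by (simp add: mult_ac)
  qed (use K_0 x y t in \<open>auto simp: add_ac\<close>)
  then have "AE z in lborel. z > 0 \<longrightarrow> K x y t z = K y t x z"
    by eventually_elim (auto simp: ennreal_mult_cancel_left)
  then have ae: "AE z in half_line. K x y t z = K y t x z"
    by (rule AE_half_line)
  have kernel: "bessel_kernel \<nu> x y t z = enn2real (K x y t z)" if "x > 0" "y > 0" for x y t z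
  proof -
    have "K x y t z = (\<integral>\<^sup>+s. ennreal (bessel_W \<nu> x y s * bessel_W \<nu> s t z * s powr (2 * \<nu> + 1)) \<partial>half_line)"
      unfolding K_def nn_integral_half_line using that
      by (intro nn_integral_cong) (auto simp: bessel_W_eq_0 split: split_indicator)
    then show ?thesis
      unfolding bessel_kernel_def
      by (subst integral_eq_nn_integral) (auto intro!: AE_I2 mult_nonneg_nonneg bessel_W_nonneg \<nu>)
  qed
  from ae show ?thesis
    by eventually_elim (simp add: kernel x y t)
qed

lemma bessel_kernel_cyclic_AE:
  assumes "\<nu> > -1/2" "x > 0" "y > 0"
  shows "AE t in half_line. AE z in half_line. bessel_kernel \<nu> x y t z = bessel_kernel \<nu> y t x z"
  using AE_half_line_pos by eventually_elim (use bessel_kernel_cyclic assms in blast)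

lemma bessel_kernel_commute: "bessel_kernel \<nu> x y t z = bessel_kernel \<nu> y x t z"
  by (simp add: bessel_kernel_def bessel_W_commute[of \<nu> x y])

text \<open>Depending on the order of the factors, the coupling variable \<open>s\<close> appears in the second or the third
  place of \<open>W\<close>.\<close>
lemma bessel_kernel_eq_rotate:
  assumes "x > 0" "y > 0"
  shows "(LINT s|half_line. bessel_W \<nu> x s y * bessel_W \<nu> s t z * s powr (2 * \<nu> + 1)) = bessel_kernel \<nu> x y t z"
  unfolding bessel_kernel_def
proof (rule integral_cong_AE)
  show "AE s in half_line. bessel_W \<nu> x s y * bessel_W \<nu> s t z * s powr (2 * \<nu> + 1)
      = bessel_W \<nu> x y s * bessel_W \<nu> s t z * s powr (2 * \<nu> + 1)"
    using AE_half_line_pos by eventually_elim (use bessel_W_rotate assms in auto)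
qed measurable

lemma borel_measurable_bessel_kernel [measurable (raw)]:
  assumes [measurable]: "f \<in> borel_measurable M" "g \<in> borel_measurable M" "h \<in> borel_measurable M" "k \<in> borel_measurable M"
  shows "(\<lambda>p. bessel_kernel \<nu> (f p) (g p) (h p) (k p)) \<in> borel_measurable M"
proof -
  interpret sigma_finite_measure half_line by (rule sigma_finite_half_line)
  show ?thesis unfolding bessel_kernel_def by measurable
qed

section \<open>Reordering iterated integrals\<close>

lemma integral_triple:
  fixes F :: "'a \<times> 'b \<times> 'c \<Rightarrow> 'd :: {banach, second_countable_topology}"
  assumes "sigma_finite_measure M1" "sigma_finite_measure M2" "sigma_finite_measure M3"
    and F: "integrable (M1 \<Otimes>\<^sub>M M2 \<Otimes>\<^sub>M M3) F"
  shows "(LINT x|M1. LINT y|M2. LINT z|M3. F (x, y, z)) = integral\<^sup>L (M1 \<Otimes>\<^sub>M M2 \<Otimes>\<^sub>M M3) F"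
proof -
  interpret M1: sigma_finite_measure M1 by fact
  interpret M2: sigma_finite_measure M2 by fact
  interpret M3: sigma_finite_measure M3 by fact
  interpret M23: pair_sigma_finite M2 M3 ..
  interpret P: sigma_finite_measure "M2 \<Otimes>\<^sub>M M3" by (rule M23.sigma_finite_measure_axioms)
  interpret Q: pair_sigma_finite M1 "M2 \<Otimes>\<^sub>M M3" ..
  have [measurable]: "F \<in> borel_measurable (M1 \<Otimes>\<^sub>M M2 \<Otimes>\<^sub>M M3)" using F by simp
  have "AE x in M1. (LINT y|M2. LINT z|M3. F (x, y, z)) = (LINT p|(M2 \<Otimes>\<^sub>M M3). F (x, p))"
    using Q.AE_integrable_fst'[OF F] by eventually_elim (rule M23.integral_fst')
  then have "(LINT x|M1. LINT y|M2. LINT z|M3. F (x, y, z)) = (LINT x|M1. LINT p|(M2 \<Otimes>\<^sub>M M3). F (x, p))"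
    by (intro integral_cong_AE) measurable
  also have "\<dots> = integral\<^sup>L (M1 \<Otimes>\<^sub>M M2 \<Otimes>\<^sub>M M3) F"
    by (rule Q.integral_fst'[OF F])
  finally show ?thesis .
qed

lemma integral_quadruple:
  fixes F :: "'a \<times> 'b \<times> 'c \<times> 'd \<Rightarrow> 'e :: {banach, second_countable_topology}"
  assumes "sigma_finite_measure M1" "sigma_finite_measure M2" "sigma_finite_measure M3"
    "sigma_finite_measure M4"
    and F: "integrable (M1 \<Otimes>\<^sub>M M2 \<Otimes>\<^sub>M M3 \<Otimes>\<^sub>M M4) F"
  shows "(LINT x|M1. LINT y|M2. LINT z|M3. LINT w|M4. F (x, y, z, w))
       = integral\<^sup>L (M1 \<Otimes>\<^sub>M M2 \<Otimes>\<^sub>M M3 \<Otimes>\<^sub>M M4) F"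
proof -
  interpret M1: sigma_finite_measure M1 by fact
  interpret M2: sigma_finite_measure M2 by fact
  interpret M3: sigma_finite_measure M3 by fact
  interpret M4: sigma_finite_measure M4 by fact
  interpret M34: pair_sigma_finite M3 M4 ..
  interpret P34: sigma_finite_measure "M3 \<Otimes>\<^sub>M M4" by (rule M34.sigma_finite_measure_axioms)
  interpret M234: pair_sigma_finite M2 "M3 \<Otimes>\<^sub>M M4" ..
  interpret P: sigma_finite_measure "M2 \<Otimes>\<^sub>M M3 \<Otimes>\<^sub>M M4" by (rule M234.sigma_finite_measure_axioms)
  interpret Q: pair_sigma_finite M1 "M2 \<Otimes>\<^sub>M M3 \<Otimes>\<^sub>M M4" ..
  have [measurable]: "F \<in> borel_measurable (M1 \<Otimes>\<^sub>M M2 \<Otimes>\<^sub>M M3 \<Otimes>\<^sub>M M4)" using F by simp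
  have "AE x in M1. (LINT y|M2. LINT z|M3. LINT w|M4. F (x, y, z, w)) = (LINT p|(M2 \<Otimes>\<^sub>M M3 \<Otimes>\<^sub>M M4). F (x, p))"
    using Q.AE_integrable_fst'[OF F] by eventually_elim (rule integral_triple[OF assms(2-4)])
  then have "(LINT x|M1. LINT y|M2. LINT z|M3. LINT w|M4. F (x, y, z, w))
      = (LINT x|M1. LINT p|(M2 \<Otimes>\<^sub>M M3 \<Otimes>\<^sub>M M4). F (x, p))"
    by (intro integral_cong_AE) measurable
  also have "\<dots> = integral\<^sup>L (M1 \<Otimes>\<^sub>M M2 \<Otimes>\<^sub>M M3 \<Otimes>\<^sub>M M4) F"
    by (rule Q.integral_fst'[OF F])
  finally show ?thesis .
qed

text \<open>In an iterated translation or convolution the variable that couples two factors \<open>W\<close> is not the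
  innermost one. This lemma and the next ones move it there, so that the kernel appears.\<close>
lemma integral_rotate_triple:
  fixes F :: "'a \<times> 'b \<times> 'c \<Rightarrow> 'd :: {banach, second_countable_topology}"
  assumes M: "sigma_finite_measure M1" "sigma_finite_measure M2" "sigma_finite_measure M3"
    and F: "integrable (M1 \<Otimes>\<^sub>M M2 \<Otimes>\<^sub>M M3) F"
  shows "(LINT x|M1. LINT y|M2. LINT z|M3. F (x, y, z)) = (LINT y|M2. LINT z|M3. LINT x|M1. F (x, y, z))"
    and "(LINT x|M1. LINT y|M2. LINT z|M3. F (x, y, z)) = (LINT z|M3. LINT y|M2. LINT x|M1. F (x, y, z))"
proof -
  interpret M1: sigma_finite_measure M1 by fact
  interpret M2: sigma_finite_measure M2 by fact
  interpret M3: sigma_finite_measure M3 by fact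
  interpret M23: pair_sigma_finite M2 M3 ..
  interpret P: sigma_finite_measure "M2 \<Otimes>\<^sub>M M3" by (rule M23.sigma_finite_measure_axioms)
  interpret Q: pair_sigma_finite M1 "M2 \<Otimes>\<^sub>M M3" ..
  have F': "integrable (M1 \<Otimes>\<^sub>M M2 \<Otimes>\<^sub>M M3) (\<lambda>(x, p). F (x, p))" using F by simp
  have C: "integrable (M2 \<Otimes>\<^sub>M M3) (\<lambda>(y, z). LINT x|M1. F (x, y, z))"
    using Q.integrable_snd[OF F'] by (simp add: case_prod_unfold)
  have "(LINT x|M1. LINT y|M2. LINT z|M3. F (x, y, z)) = (LINT p|(M2 \<Otimes>\<^sub>M M3). LINT x|M1. F (x, p))"
    unfolding integral_triple[OF M F] Q.integral_snd[OF F'] by simp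
  then have *: "(LINT x|M1. LINT y|M2. LINT z|M3. F (x, y, z)) = (LINT (y, z)|(M2 \<Otimes>\<^sub>M M3). LINT x|M1. F (x, y, z))"
    by (simp add: case_prod_unfold)
  show "(LINT x|M1. LINT y|M2. LINT z|M3. F (x, y, z)) = (LINT y|M2. LINT z|M3. LINT x|M1. F (x, y, z))"
    unfolding * by (rule M23.integral_fst[OF C, symmetric])
  show "(LINT x|M1. LINT y|M2. LINT z|M3. F (x, y, z)) = (LINT z|M3. LINT y|M2. LINT x|M1. F (x, y, z))"
    unfolding * by (rule M23.integral_snd[OF C, symmetric])
qed

lemma integral_swap_inner:
  fixes F :: "'a \<times> 'b \<times> 'c \<Rightarrow> 'd :: {banach, second_countable_topology}"
  assumes M: "sigma_finite_measure M1" "sigma_finite_measure M2" "sigma_finite_measure M3"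
    and F: "integrable (M1 \<Otimes>\<^sub>M M2 \<Otimes>\<^sub>M M3) F"
  shows "(LINT x|M1. LINT y|M2. LINT z|M3. F (x, y, z)) = (LINT x|M1. LINT z|M3. LINT y|M2. F (x, y, z))"
proof -
  interpret M1: sigma_finite_measure M1 by fact
  interpret M2: sigma_finite_measure M2 by fact
  interpret M3: sigma_finite_measure M3 by fact
  interpret M23: pair_sigma_finite M2 M3 ..
  interpret P: sigma_finite_measure "M2 \<Otimes>\<^sub>M M3" by (rule M23.sigma_finite_measure_axioms)
  interpret Q: pair_sigma_finite M1 "M2 \<Otimes>\<^sub>M M3" ..
  have [measurable]: "F \<in> borel_measurable (M1 \<Otimes>\<^sub>M M2 \<Otimes>\<^sub>M M3)" using F by simp
  have "AE x in M1. (LINT y|M2. LINT z|M3. F (x, y, z)) = (LINT z|M3. LINT y|M2. F (x, y, z))"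
    using Q.AE_integrable_fst'[OF F]
  proof eventually_elim
    case (elim x)
    then show ?case using M23.Fubini_integral[of "\<lambda>y z. F (x, y, z)"]
      by (simp add: case_prod_unfold)
  qed
  then show ?thesis
    by (intro integral_cong_AE) (measurable)
qed

lemma integral_quadruple_second_to_last:
  fixes F :: "'a \<times> 'b \<times> 'c \<times> 'd \<Rightarrow> 'e :: {banach, second_countable_topology}"
  assumes M: "sigma_finite_measure M1" "sigma_finite_measure M2" "sigma_finite_measure M3"
    "sigma_finite_measure M4"
    and F: "integrable (M1 \<Otimes>\<^sub>M M2 \<Otimes>\<^sub>M M3 \<Otimes>\<^sub>M M4) F"
  shows "(LINT x|M1. LINT y|M2. LINT z|M3. LINT w|M4. F (x, y, z, w))
       = (LINT x|M1. LINT z|M3. LINT w|M4. LINT y|M2. F (x, y, z, w))"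
proof -
  interpret M1: sigma_finite_measure M1 by fact
  interpret M2: sigma_finite_measure M2 by fact
  interpret M3: sigma_finite_measure M3 by fact
  interpret M4: sigma_finite_measure M4 by fact
  interpret M34: pair_sigma_finite M3 M4 ..
  interpret P34: sigma_finite_measure "M3 \<Otimes>\<^sub>M M4" by (rule M34.sigma_finite_measure_axioms)
  interpret M234: pair_sigma_finite M2 "M3 \<Otimes>\<^sub>M M4" ..
  interpret P: sigma_finite_measure "M2 \<Otimes>\<^sub>M M3 \<Otimes>\<^sub>M M4" by (rule M234.sigma_finite_measure_axioms)
  interpret Q: pair_sigma_finite M1 "M2 \<Otimes>\<^sub>M M3 \<Otimes>\<^sub>M M4" ..
  have [measurable]: "F \<in> borel_measurable (M1 \<Otimes>\<^sub>M M2 \<Otimes>\<^sub>M M3 \<Otimes>\<^sub>M M4)" using F by simp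
  have "AE x in M1. (LINT y|M2. LINT z|M3. LINT w|M4. F (x, y, z, w)) = (LINT z|M3. LINT w|M4. LINT y|M2. F (x, y, z, w))"
    using Q.AE_integrable_fst'[OF F]
    by eventually_elim (rule integral_rotate_triple(1)[OF M(2-4)])
  then show ?thesis
    by (intro integral_cong_AE) measurable
qed

lemma integral_quadruple_first_two_to_last:
  fixes F :: "'a \<times> 'b \<times> 'c \<times> 'd \<Rightarrow> 'e :: {banach, second_countable_topology}"
  assumes M: "sigma_finite_measure M1" "sigma_finite_measure M2" "sigma_finite_measure M3"
    "sigma_finite_measure M4"
    and F: "integrable (M1 \<Otimes>\<^sub>M M2 \<Otimes>\<^sub>M M3 \<Otimes>\<^sub>M M4) F"
  shows "(LINT x|M1. LINT y|M2. LINT z|M3. LINT w|M4. F (x, y, z, w))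
       = (LINT z|M3. LINT w|M4. LINT y|M2. LINT x|M1. F (x, y, z, w))"
proof -
  interpret M1: sigma_finite_measure M1 by fact
  interpret M2: sigma_finite_measure M2 by fact
  interpret M3: sigma_finite_measure M3 by fact
  interpret M4: sigma_finite_measure M4 by fact
  interpret M34: pair_sigma_finite M3 M4 ..
  interpret P34: sigma_finite_measure "M3 \<Otimes>\<^sub>M M4" by (rule M34.sigma_finite_measure_axioms)
  interpret M234: pair_sigma_finite M2 "M3 \<Otimes>\<^sub>M M4" ..
  interpret P: sigma_finite_measure "M2 \<Otimes>\<^sub>M M3 \<Otimes>\<^sub>M M4" by (rule M234.sigma_finite_measure_axioms)
  interpret Q: pair_sigma_finite M1 "M2 \<Otimes>\<^sub>M M3 \<Otimes>\<^sub>M M4" ..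
  have F': "integrable (M1 \<Otimes>\<^sub>M M2 \<Otimes>\<^sub>M M3 \<Otimes>\<^sub>M M4) (\<lambda>(x, p). F (x, p))" using F by simp
  have C: "integrable (M2 \<Otimes>\<^sub>M M3 \<Otimes>\<^sub>M M4) (\<lambda>p. LINT x|M1. F (x, p))"
    using Q.integrable_snd[OF F'] .
  have "(LINT x|M1. LINT y|M2. LINT z|M3. LINT w|M4. F (x, y, z, w)) = (LINT p|(M2 \<Otimes>\<^sub>M M3 \<Otimes>\<^sub>M M4). LINT x|M1. F (x, p))"
    unfolding integral_quadruple[OF M F] Q.integral_snd[OF F'] by simp
  also have "\<dots> = (LINT y|M2. LINT z|M3. LINT w|M4. LINT x|M1. F (x, y, z, w))"
    using integral_triple[OF M(2-4) C] by simp
  also have "\<dots> = (LINT z|M3. LINT w|M4. LINT y|M2. LINT x|M1. F (x, y, z, w))"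
    using integral_rotate_triple(1)[OF M(2-4) C] by simp
  finally show ?thesis .
qed

text \<open>The iterated form of the hypothesis is the one that \<open>bessel_kernel_cyclic\<close> provides: the null set of
  exceptional \<open>z\<close> may depend on \<open>t\<close>.\<close>
lemma iterated_integral_cong_kernel:
  fixes A :: "real \<Rightarrow> real \<Rightarrow> complex"
  assumes [measurable]: "(\<lambda>(t, z). A t z) \<in> borel_measurable (half_line \<Otimes>\<^sub>M half_line)"
    "(\<lambda>(t, z). K t z) \<in> borel_measurable (half_line \<Otimes>\<^sub>M half_line)"
    "(\<lambda>(t, z). L t z) \<in> borel_measurable (half_line \<Otimes>\<^sub>M half_line)"
    and ae: "AE t in half_line. AE z in half_line. K t z = L t z"
  shows "(LINT t|half_line. LINT z|half_line. A t z * of_real (K t z))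
       = (LINT t|half_line. LINT z|half_line. A t z * of_real (L t z))"
proof -
  interpret sigma_finite_measure half_line by (rule sigma_finite_half_line)
  have "AE t in half_line. (LINT z|half_line. A t z * of_real (K t z)) = (LINT z|half_line. A t z * of_real (L t z))"
    using ae AE_space
  proof eventually_elim
    case (elim t)
    note [measurable] = elim(2)
    show ?case
      using elim(1) by (intro integral_cong_AE) (measurable, auto elim: eventually_mono)
  qed
  then show ?thesis
    by (intro integral_cong_AE) measurable
qed

section \<open>Cancellation of the phases\<close>

lemma chirp_add: "chirp m s * chirp m t = chirp m (s + t)"
  by (simp add: chirp_def distrib_left flip: exp_add)

lemma borel_measurable_chirp [measurable (raw)]:
  "u \<in> borel_measurable M \<Longrightarrow> (\<lambda>p. chirp m (u p)) \<in> borel_measurable M"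
  unfolding chirp_def by measurable

text \<open>The phase of the transform with matrix \<open>m\<close> is removed, which turns the convolution of \<open>f\<close> and \<open>g\<close>
  into the classical one of the dechirped functions.\<close>
definition dechirp :: "real^2^2 \<Rightarrow> (real \<Rightarrow> complex) \<Rightarrow> real \<Rightarrow> complex" where
  "dechirp m f s = chirp m (- (s\<^sup>2) / 2) * f s"

lemma m_translation_integrand_eq:
  "m_translation_integrand \<nu> m x f y z =
     chirp m ((x\<^sup>2 + y\<^sup>2) / 2) * dechirp m f z * of_real (bessel_W \<nu> x y z * z powr (2 * \<nu> + 1))"
  by (simp add: m_translation_integrand_def bessel_translation_integrand_def dechirp_def)

lemma m_conv_integrand_eq:
  "m_conv_integrand \<nu> m f g x y z =
     chirp m (x\<^sup>2 / 2) * dechirp m f z * dechirp m g y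
     * of_real (bessel_W \<nu> x y z * z powr (2 * \<nu> + 1) * y powr (2 * \<nu> + 1))"
proof -
  have "chirp m ((x\<^sup>2 + y\<^sup>2) / 2) * chirp m (- (y\<^sup>2)) = chirp m (x\<^sup>2 / 2) * chirp m (- (y\<^sup>2) / 2)"
    by (simp add: chirp_add field_simps)
  then show ?thesis
    by (simp add: m_conv_integrand_def m_translation_integrand_eq dechirp_def[of m g] mult_ac)
qed

text \<open>The phase outside the convolution is exactly the one that \<open>dechirp\<close> removes, so inner convolutions
  contribute no phase.\<close>
lemma dechirp_m_conv_integrand:
  "dechirp m (\<lambda>x. m_conv_integrand \<nu> m f g x y z) x =
     dechirp m f z * dechirp m g y * of_real (bessel_W \<nu> x y z * z powr (2 * \<nu> + 1) * y powr (2 * \<nu> + 1))"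
proof -
  have "chirp m (- (x\<^sup>2) / 2) * chirp m (x\<^sup>2 / 2) = 1"
    by (simp add: chirp_add) (simp add: chirp_def)
  then show ?thesis
    by (simp add: dechirp_def[of m _ x] m_conv_integrand_eq flip: mult.assoc)
qed

lemma dechirp_m_translation_integrand:
  "dechirp m (\<lambda>y. m_translation_integrand \<nu> m x f y z) y =
     chirp m (x\<^sup>2 / 2) * dechirp m f z * of_real (bessel_W \<nu> x y z * z powr (2 * \<nu> + 1))"
proof -
  have "chirp m (- (y\<^sup>2) / 2) * chirp m ((x\<^sup>2 + y\<^sup>2) / 2) = chirp m (x\<^sup>2 / 2)"
    by (simp add: chirp_add field_simps)
  then show ?thesis
    by (simp add: dechirp_def[of m _ y] m_translation_integrand_eq flip: mult.assoc)
qed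

lemma dechirp_integral:
  "dechirp m (\<lambda>x. LINT y|M. k x y) x = (LINT y|M. dechirp m (\<lambda>x. k x y) x)"
  by (simp add: dechirp_def)

lemma m_translation_integrand_integral:
  "m_translation_integrand \<nu> m x (\<lambda>s. LINT p|M. k s p) y z = (LINT p|M. m_translation_integrand \<nu> m x (\<lambda>s. k s p) y z)"
  by (simp add: m_translation_integrand_eq dechirp_integral)

lemma m_conv_integrand_integral:
  "m_conv_integrand \<nu> m (\<lambda>s. LINT p|M. k s p) g x y z = (LINT p|M. m_conv_integrand \<nu> m (\<lambda>s. k s p) g x y z)"
  "m_conv_integrand \<nu> m f (\<lambda>s. LINT p|M. k s p) x y z = (LINT p|M. m_conv_integrand \<nu> m f (\<lambda>s. k s p) x y z)"
  by (simp_all add: m_conv_integrand_eq dechirp_integral)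

lemma borel_measurable_dechirp [measurable]:
  "f \<in> borel_measurable half_line \<Longrightarrow> dechirp m f \<in> borel_measurable half_line"
  unfolding dechirp_def[abs_def] by measurable

lemma m_translation_fun_eq_integral:
  "m_translation \<nu> m x f = (\<lambda>y. LINT z|half_line. m_translation_integrand \<nu> m x f y z)"
  by (simp add: fun_eq_iff m_translation_eq_integral)

lemma m_conv_fun_eq_integral:
  "m_conv \<nu> m f g = (\<lambda>x. LINT y|half_line. LINT z|half_line. m_conv_integrand \<nu> m f g x y z)"
  by (simp add: fun_eq_iff m_conv_eq_integral)

text \<open>The contribution of \<open>f\<close> at \<open>z\<close> and \<open>g\<close> at \<open>t\<close>, weights included, common to the integrands below.\<close>
definition pair_factor ::
  "real \<Rightarrow> real^2^2 \<Rightarrow> (real \<Rightarrow> complex) \<Rightarrow> (real \<Rightarrow> complex) \<Rightarrow> real \<Rightarrow> real \<Rightarrow> complex" where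
  "pair_factor \<nu> m f g t z =
     dechirp m f z * dechirp m g t * of_real (z powr (2 * \<nu> + 1) * t powr (2 * \<nu> + 1))"

lemma borel_measurable_pair_factor [measurable]:
  assumes [measurable]: "f \<in> borel_measurable half_line" "g \<in> borel_measurable half_line"
  shows "(\<lambda>(t, z). pair_factor \<nu> m f g t z) \<in> borel_measurable (half_line \<Otimes>\<^sub>M half_line)"
  unfolding pair_factor_def by measurable

lemma translation_of_conv_integrand:
  "m_translation_integrand \<nu> m x (\<lambda>s. m_conv_integrand \<nu> m f g s t z) y s =
     chirp m ((x\<^sup>2 + y\<^sup>2) / 2) * pair_factor \<nu> m f g t z
     * of_real (bessel_W \<nu> x y s * bessel_W \<nu> s t z * s powr (2 * \<nu> + 1))"
  by (simp add: m_translation_integrand_eq dechirp_m_conv_integrand pair_factor_def mult_ac)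

lemma chirp_half_squares: "chirp m ((x\<^sup>2 + y\<^sup>2) / 2) = chirp m (x\<^sup>2 / 2) * chirp m (y\<^sup>2 / 2)"
  by (simp add: chirp_add field_simps)

lemma conv_of_translation_left_integrand:
  "m_conv_integrand \<nu> m (\<lambda>s. m_translation_integrand \<nu> m x f s z) g y t s =
     chirp m ((x\<^sup>2 + y\<^sup>2) / 2) * pair_factor \<nu> m f g t z
     * of_real (bessel_W \<nu> y t s * bessel_W \<nu> s x z * s powr (2 * \<nu> + 1))"
  by (simp add: m_conv_integrand_eq dechirp_m_translation_integrand pair_factor_def
      chirp_half_squares bessel_W_commute[of \<nu> x s] mult_ac)

lemma conv_of_translation_right_integrand:
  "m_conv_integrand \<nu> m f (\<lambda>t. m_translation_integrand \<nu> m x g t w) y t z =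
     chirp m ((x\<^sup>2 + y\<^sup>2) / 2) * pair_factor \<nu> m f g w z
     * of_real (bessel_W \<nu> x t w * bessel_W \<nu> t y z * t powr (2 * \<nu> + 1))"
  by (simp add: m_conv_integrand_eq dechirp_m_translation_integrand pair_factor_def
      chirp_half_squares bessel_W_commute[of \<nu> y t] mult_ac)

lemma conv_of_conv_left_integrand:
  "m_conv_integrand \<nu> m (\<lambda>s. m_conv_integrand \<nu> m f g s t z) h x y s =
     chirp m (x\<^sup>2 / 2) * dechirp m h y * of_real (y powr (2 * \<nu> + 1)) * pair_factor \<nu> m f g t z
     * of_real (bessel_W \<nu> x y s * bessel_W \<nu> s t z * s powr (2 * \<nu> + 1))"
  unfolding m_conv_integrand_eq[of \<nu> m "\<lambda>s. m_conv_integrand \<nu> m f g s t z"] dechirp_m_conv_integrand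
  by (simp add: pair_factor_def mult_ac)

lemma conv_of_conv_right_integrand:
  "m_conv_integrand \<nu> m f (\<lambda>y. m_conv_integrand \<nu> m g h y t w) x y z =
     chirp m (x\<^sup>2 / 2) * dechirp m h t * of_real (t powr (2 * \<nu> + 1)) * pair_factor \<nu> m f g w z
     * of_real (bessel_W \<nu> t y w * bessel_W \<nu> y x z * y powr (2 * \<nu> + 1))"
  unfolding m_conv_integrand_eq[of \<nu> m f "\<lambda>y. m_conv_integrand \<nu> m g h y t w"] dechirp_m_conv_integrand
  by (simp add: pair_factor_def bessel_W_commute[of \<nu> x y] bessel_W_commute[of \<nu> y t] mult_ac)

lemma translation_of_conv_eq:
  assumes "integrable (half_line \<Otimes>\<^sub>M half_line \<Otimes>\<^sub>M half_line)
       (\<lambda>(s, t, z). m_translation_integrand \<nu> m x (\<lambda>s. m_conv_integrand \<nu> m f g s t z) y s)"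
  shows "m_translation \<nu> m x (m_conv \<nu> m f g) y
     = (LINT t|half_line. LINT z|half_line. chirp m ((x\<^sup>2 + y\<^sup>2) / 2) * pair_factor \<nu> m f g t z
          * of_real (bessel_kernel \<nu> x y t z))"
proof -
  have "m_translation \<nu> m x (m_conv \<nu> m f g) y = (LINT s|half_line. LINT t|half_line. LINT z|half_line.
      m_translation_integrand \<nu> m x (\<lambda>s. m_conv_integrand \<nu> m f g s t z) y s)"
    by (simp only: m_translation_eq_integral m_conv_fun_eq_integral m_translation_integrand_integral)
  also have "\<dots> = (LINT t|half_line. LINT z|half_line. LINT s|half_line.
      m_translation_integrand \<nu> m x (\<lambda>s. m_conv_integrand \<nu> m f g s t z) y s)"
    using integral_rotate_triple(1)[OF sigma_finite_half_line sigma_finite_half_line sigma_finite_half_line assms]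
    by simp
  finally show ?thesis
    by (simp only: translation_of_conv_integrand integral_mult_right_zero integral_complex_of_real bessel_kernel_def)
qed

lemma conv_of_translation_left_eq:
  assumes "integrable (half_line \<Otimes>\<^sub>M half_line \<Otimes>\<^sub>M half_line)
       (\<lambda>(t, s, z). m_conv_integrand \<nu> m (\<lambda>s. m_translation_integrand \<nu> m x f s z) g y t s)"
  shows "m_conv \<nu> m (m_translation \<nu> m x f) g y
     = (LINT t|half_line. LINT z|half_line. chirp m ((x\<^sup>2 + y\<^sup>2) / 2) * pair_factor \<nu> m f g t z
          * of_real (bessel_kernel \<nu> y t x z))"
proof -
  have "m_conv \<nu> m (m_translation \<nu> m x f) g y = (LINT t|half_line. LINT s|half_line. LINT z|half_line.
      m_conv_integrand \<nu> m (\<lambda>s. m_translation_integrand \<nu> m x f s z) g y t s)"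
    by (simp only: m_conv_eq_integral m_translation_fun_eq_integral m_conv_integrand_integral)
  also have "\<dots> = (LINT t|half_line. LINT z|half_line. LINT s|half_line.
      m_conv_integrand \<nu> m (\<lambda>s. m_translation_integrand \<nu> m x f s z) g y t s)"
    using integral_swap_inner[OF sigma_finite_half_line sigma_finite_half_line sigma_finite_half_line assms]
    by simp
  finally show ?thesis
    by (simp only: conv_of_translation_left_integrand integral_mult_right_zero integral_complex_of_real bessel_kernel_def)
qed

lemma conv_of_translation_right_eq:
  assumes [measurable]: "f \<in> borel_measurable half_line" "g \<in> borel_measurable half_line"
    and x: "x > 0"
    and int: "integrable (half_line \<Otimes>\<^sub>M half_line \<Otimes>\<^sub>M half_line)
       (\<lambda>(t, z, w). m_conv_integrand \<nu> m f (\<lambda>t. m_translation_integrand \<nu> m x g t w) y t z)"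
  shows "m_conv \<nu> m f (m_translation \<nu> m x g) y
     = (LINT t|half_line. LINT z|half_line. chirp m ((x\<^sup>2 + y\<^sup>2) / 2) * pair_factor \<nu> m f g t z
          * of_real (bessel_kernel \<nu> x t y z))"
proof -
  interpret H: sigma_finite_measure half_line by (rule sigma_finite_half_line)
  have "m_conv \<nu> m f (m_translation \<nu> m x g) y = (LINT t|half_line. LINT z|half_line. LINT w|half_line.
      m_conv_integrand \<nu> m f (\<lambda>t. m_translation_integrand \<nu> m x g t w) y t z)"
    by (simp only: m_conv_eq_integral m_translation_fun_eq_integral m_conv_integrand_integral)
  also have "\<dots> = (LINT w|half_line. LINT z|half_line. LINT t|half_line.
      m_conv_integrand \<nu> m f (\<lambda>t. m_translation_integrand \<nu> m x g t w) y t z)"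
    using integral_rotate_triple(2)[OF sigma_finite_half_line sigma_finite_half_line sigma_finite_half_line int]
    by simp
  also have "\<dots> = (LINT w|half_line. LINT z|half_line. chirp m ((x\<^sup>2 + y\<^sup>2) / 2) * pair_factor \<nu> m f g w z
      * of_real (LINT t|half_line. bessel_W \<nu> x t w * bessel_W \<nu> t y z * t powr (2 * \<nu> + 1)))"
    by (simp only: conv_of_translation_right_integrand integral_mult_right_zero integral_complex_of_real)
  also have "\<dots> = (LINT w|half_line. LINT z|half_line. chirp m ((x\<^sup>2 + y\<^sup>2) / 2) * pair_factor \<nu> m f g w z
      * of_real (bessel_kernel \<nu> x w y z))"
  proof (rule iterated_integral_cong_kernel)
    show "AE w in half_line. AE z in half_line.
        (LINT t|half_line. bessel_W \<nu> x t w * bessel_W \<nu> t y z * t powr (2 * \<nu> + 1)) = bessel_kernel \<nu> x w y z"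
      using AE_half_line_pos by eventually_elim (simp add: bessel_kernel_eq_rotate x)
  qed measurable
  finally show ?thesis .
qed

lemma conv_of_conv_left_eq:
  assumes int: "integrable (half_line \<Otimes>\<^sub>M half_line \<Otimes>\<^sub>M half_line \<Otimes>\<^sub>M half_line)
       (\<lambda>(y, s, t, z). m_conv_integrand \<nu> m (\<lambda>s. m_conv_integrand \<nu> m f g s t z) h x y s)"
  shows "m_conv \<nu> m (m_conv \<nu> m f g) h x
     = (LINT y|half_line. LINT t|half_line. LINT z|half_line.
          chirp m (x\<^sup>2 / 2) * dechirp m h y * of_real (y powr (2 * \<nu> + 1)) * pair_factor \<nu> m f g t z
          * of_real (bessel_kernel \<nu> x y t z))"
proof -
  have "m_conv \<nu> m (m_conv \<nu> m f g) h x = (LINT y|half_line. LINT s|half_line. LINT t|half_line. LINT z|half_line.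
      m_conv_integrand \<nu> m (\<lambda>s. m_conv_integrand \<nu> m f g s t z) h x y s)"
    by (simp only: m_conv_eq_integral m_conv_fun_eq_integral m_conv_integrand_integral)
  also have "\<dots> = (LINT y|half_line. LINT t|half_line. LINT z|half_line. LINT s|half_line.
      m_conv_integrand \<nu> m (\<lambda>s. m_conv_integrand \<nu> m f g s t z) h x y s)"
    using integral_quadruple_second_to_last[OF sigma_finite_half_line sigma_finite_half_line
        sigma_finite_half_line sigma_finite_half_line int]
    by simp
  finally show ?thesis
    by (simp only: conv_of_conv_left_integrand integral_mult_right_zero integral_complex_of_real bessel_kernel_def)
qed

lemma conv_of_conv_right_eq:
  assumes [measurable]: "f \<in> borel_measurable half_line" "g \<in> borel_measurable half_line"
     "h \<in> borel_measurable half_line"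
    and int: "integrable (half_line \<Otimes>\<^sub>M half_line \<Otimes>\<^sub>M half_line \<Otimes>\<^sub>M half_line)
       (\<lambda>(y, z, t, w). m_conv_integrand \<nu> m f (\<lambda>y. m_conv_integrand \<nu> m g h y t w) x y z)"
  shows "m_conv \<nu> m f (m_conv \<nu> m g h) x
     = (LINT y|half_line. LINT t|half_line. LINT z|half_line.
          chirp m (x\<^sup>2 / 2) * dechirp m h y * of_real (y powr (2 * \<nu> + 1)) * pair_factor \<nu> m f g t z
          * of_real (bessel_kernel \<nu> y t x z))"
proof -
  interpret H: sigma_finite_measure half_line by (rule sigma_finite_half_line)
  have "m_conv \<nu> m f (m_conv \<nu> m g h) x = (LINT y|half_line. LINT z|half_line. LINT t|half_line. LINT w|half_line.
      m_conv_integrand \<nu> m f (\<lambda>y. m_conv_integrand \<nu> m g h y t w) x y z)"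
    by (simp only: m_conv_eq_integral m_conv_fun_eq_integral m_conv_integrand_integral)
  also have "\<dots> = (LINT t|half_line. LINT w|half_line. LINT z|half_line. LINT y|half_line.
      m_conv_integrand \<nu> m f (\<lambda>y. m_conv_integrand \<nu> m g h y t w) x y z)"
    using integral_quadruple_first_two_to_last[OF sigma_finite_half_line sigma_finite_half_line
        sigma_finite_half_line sigma_finite_half_line int]
    by simp
  also have "\<dots> = (LINT t|half_line. LINT w|half_line. LINT z|half_line.
      chirp m (x\<^sup>2 / 2) * dechirp m h t * of_real (t powr (2 * \<nu> + 1)) * pair_factor \<nu> m f g w z
      * of_real (LINT y|half_line. bessel_W \<nu> t y w * bessel_W \<nu> y x z * y powr (2 * \<nu> + 1)))"
    by (simp only: conv_of_conv_right_integrand integral_mult_right_zero integral_complex_of_real)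
  also have "\<dots> = (LINT t|half_line. LINT w|half_line. LINT z|half_line.
      chirp m (x\<^sup>2 / 2) * dechirp m h t * of_real (t powr (2 * \<nu> + 1)) * pair_factor \<nu> m f g w z
      * of_real (bessel_kernel \<nu> t w x z))"
  proof (rule integral_cong_AE)
    show "AE t in half_line. (LINT w|half_line. LINT z|half_line.
      chirp m (x\<^sup>2 / 2) * dechirp m h t * of_real (t powr (2 * \<nu> + 1)) * pair_factor \<nu> m f g w z
      * of_real (LINT y|half_line. bessel_W \<nu> t y w * bessel_W \<nu> y x z * y powr (2 * \<nu> + 1)))
      = (LINT w|half_line. LINT z|half_line.
      chirp m (x\<^sup>2 / 2) * dechirp m h t * of_real (t powr (2 * \<nu> + 1)) * pair_factor \<nu> m f g w z
      * of_real (bessel_kernel \<nu> t w x z))"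
      using AE_half_line_pos
    proof eventually_elim
      case (elim t)
      show ?case
      proof (rule iterated_integral_cong_kernel)
        show "AE w in half_line. AE z in half_line.
           (LINT y|half_line. bessel_W \<nu> t y w * bessel_W \<nu> y x z * y powr (2 * \<nu> + 1)) = bessel_kernel \<nu> t w x z"
          using AE_half_line_pos by eventually_elim (simp add: bessel_kernel_eq_rotate elim)
      qed measurable
    qed
  qed measurable
  finally show ?thesis .
qed

section \<open>Commutativity and associativity\<close>

lemma m_conv_commute:
  assumes [measurable]: "f \<in> borel_measurable half_line" "g \<in> borel_measurable half_line"
    and x: "x > 0"
    and int: "integrable (half_line \<Otimes>\<^sub>M half_line) (\<lambda>(y, z). m_conv_integrand \<nu> m f g x y z)"
  shows "m_conv \<nu> m f g x = m_conv \<nu> m g f x"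
proof -
  interpret H: sigma_finite_measure half_line by (rule sigma_finite_half_line)
  interpret pair_sigma_finite half_line half_line ..
  have [measurable]: "dechirp m f \<in> borel_measurable half_line" "dechirp m g \<in> borel_measurable half_line"
    unfolding dechirp_def[abs_def] by measurable
  define A where "A y z = chirp m (x\<^sup>2 / 2) * dechirp m f y * dechirp m g z * of_real (y powr (2 * \<nu> + 1) * z powr (2 * \<nu> + 1))" for y z
  have "m_conv \<nu> m f g x = (LINT z|half_line. LINT y|half_line. m_conv_integrand \<nu> m f g x y z)"
    unfolding m_conv_eq_integral using Fubini_integral[OF int] by simp
  also have "\<dots> = (LINT z|half_line. LINT y|half_line. A z y * of_real (bessel_W \<nu> x y z))"
    by (simp add: m_conv_integrand_eq A_def mult_ac)
  also have "\<dots> = (LINT z|half_line. LINT y|half_line. A z y * of_real (bessel_W \<nu> x z y))"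
  proof (rule iterated_integral_cong_kernel)
    show "AE z in half_line. AE y in half_line. bessel_W \<nu> x y z = bessel_W \<nu> x z y"
      using AE_half_line_pos
    proof eventually_elim
      case (elim z)
      show ?case
        using AE_half_line_pos by eventually_elim (rule bessel_W_rotate[OF x _ elim])
    qed
  qed (unfold A_def, measurable)
  also have "\<dots> = m_conv \<nu> m g f x"
    by (simp add: m_conv_eq_integral m_conv_integrand_eq A_def mult_ac)
  finally show ?thesis .
qed

lemma m_translation_m_conv_left:
  assumes \<nu>: "\<nu> > -1/2" and x: "x > 0" and y: "y > 0"
    and [measurable]: "f \<in> borel_measurable half_line" "g \<in> borel_measurable half_line"
    and int: "integrable (half_line \<Otimes>\<^sub>M half_line \<Otimes>\<^sub>M half_line)
         (\<lambda>(s, t, z). m_translation_integrand \<nu> m x (\<lambda>s. m_conv_integrand \<nu> m f g s t z) y s)"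
      "integrable (half_line \<Otimes>\<^sub>M half_line \<Otimes>\<^sub>M half_line)
         (\<lambda>(t, s, z). m_conv_integrand \<nu> m (\<lambda>s. m_translation_integrand \<nu> m x f s z) g y t s)"
  shows "m_translation \<nu> m x (m_conv \<nu> m f g) y = m_conv \<nu> m (m_translation \<nu> m x f) g y"
  unfolding translation_of_conv_eq[OF int(1)] conv_of_translation_left_eq[OF int(2)]
proof (rule iterated_integral_cong_kernel)
  show "AE t in half_line. AE z in half_line. bessel_kernel \<nu> x y t z = bessel_kernel \<nu> y t x z"
    by (rule bessel_kernel_cyclic_AE[OF \<nu> x y])
qed measurable

text \<open>Two cyclic shifts and the symmetry of the kernel in its first two arguments.\<close>
lemma m_translation_m_conv_right:
  assumes \<nu>: "\<nu> > -1/2" and x: "x > 0" and y: "y > 0"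
    and [measurable]: "f \<in> borel_measurable half_line" "g \<in> borel_measurable half_line"
    and int: "integrable (half_line \<Otimes>\<^sub>M half_line \<Otimes>\<^sub>M half_line)
         (\<lambda>(t, s, z). m_conv_integrand \<nu> m (\<lambda>s. m_translation_integrand \<nu> m x f s z) g y t s)"
      "integrable (half_line \<Otimes>\<^sub>M half_line \<Otimes>\<^sub>M half_line)
         (\<lambda>(t, z, w). m_conv_integrand \<nu> m f (\<lambda>t. m_translation_integrand \<nu> m x g t w) y t z)"
  shows "m_conv \<nu> m (m_translation \<nu> m x f) g y = m_conv \<nu> m f (m_translation \<nu> m x g) y"
  unfolding conv_of_translation_left_eq[OF int(1)]
    conv_of_translation_right_eq[OF \<open>f \<in> borel_measurable half_line\<close> \<open>g \<in> borel_measurable half_line\<close> x int(2)]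
proof (rule iterated_integral_cong_kernel)
  show "AE t in half_line. AE z in half_line. bessel_kernel \<nu> y t x z = bessel_kernel \<nu> x t y z"
    using AE_half_line_pos
  proof eventually_elim
    case (elim t)
    show ?case
      using bessel_kernel_cyclic[OF \<nu> x y elim] bessel_kernel_cyclic[OF \<nu> elim x y]
      by eventually_elim (simp add: bessel_kernel_commute[of \<nu> x t])
  qed
qed measurable

lemma m_conv_assoc:
  assumes \<nu>: "\<nu> > -1/2" and x: "x > 0"
    and [measurable]: "f \<in> borel_measurable half_line" "g \<in> borel_measurable half_line" "h \<in> borel_measurable half_line"
    and int: "integrable (half_line \<Otimes>\<^sub>M half_line \<Otimes>\<^sub>M half_line \<Otimes>\<^sub>M half_line)
          (\<lambda>(y, s, t, z). m_conv_integrand \<nu> m (\<lambda>s. m_conv_integrand \<nu> m f g s t z) h x y s)"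
      "integrable (half_line \<Otimes>\<^sub>M half_line \<Otimes>\<^sub>M half_line \<Otimes>\<^sub>M half_line)
          (\<lambda>(y, z, t, w). m_conv_integrand \<nu> m f (\<lambda>y. m_conv_integrand \<nu> m g h y t w) x y z)"
  shows "m_conv \<nu> m (m_conv \<nu> m f g) h x = m_conv \<nu> m f (m_conv \<nu> m g h) x"
proof -
  interpret H: sigma_finite_measure half_line by (rule sigma_finite_half_line)
  show ?thesis
    unfolding conv_of_conv_left_eq[OF int(1)] conv_of_conv_right_eq[OF assms(3-5) int(2)]
  proof (rule integral_cong_AE)
    show "AE y in half_line. (LINT t|half_line. LINT z|half_line.
          chirp m (x\<^sup>2 / 2) * dechirp m h y * of_real (y powr (2 * \<nu> + 1)) * pair_factor \<nu> m f g t z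
          * of_real (bessel_kernel \<nu> x y t z))
        = (LINT t|half_line. LINT z|half_line.
          chirp m (x\<^sup>2 / 2) * dechirp m h y * of_real (y powr (2 * \<nu> + 1)) * pair_factor \<nu> m f g t z
          * of_real (bessel_kernel \<nu> y t x z))"
      using AE_half_line_pos
    proof eventually_elim
      case (elim y)
      show ?case
        by (rule iterated_integral_cong_kernel[OF _ _ _ bessel_kernel_cyclic_AE[OF \<nu> x elim]]) measurable
    qed
  qed measurable
qed

theorem proposition3p4:
  fixes \<nu> :: real and m :: "real^2^2" and f g h :: "real \<Rightarrow> complex"
  assumes "\<nu> > - 1/2"
    and "det m = 1" and "m $ 1 $ 2 \<noteq> 0"
    and "f \<in> borel_measurable (lebesgue_on {0..})"
    and "g \<in> borel_measurable (lebesgue_on {0..})"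
    and "h \<in> borel_measurable (lebesgue_on {0..})"
  shows
    "(\<forall>x>0.
        integrable (half_line \<Otimes>\<^sub>M half_line) (\<lambda>(y, z). m_conv_integrand \<nu> m f g x y z) \<longrightarrow>
        integrable (half_line \<Otimes>\<^sub>M half_line) (\<lambda>(y, z). m_conv_integrand \<nu> m g f x y z) \<longrightarrow>
        m_conv \<nu> m f g x = m_conv \<nu> m g f x)
     \<and>
     (\<forall>x>0. \<forall>y>0.
        (integrable (half_line \<Otimes>\<^sub>M half_line \<Otimes>\<^sub>M half_line)
           (\<lambda>(s, t, z). m_translation_integrand \<nu> m x (\<lambda>s. m_conv_integrand \<nu> m f g s t z) y s) \<longrightarrow>
         integrable (half_line \<Otimes>\<^sub>M half_line \<Otimes>\<^sub>M half_line)
           (\<lambda>(t, s, z). m_conv_integrand \<nu> m (\<lambda>s. m_translation_integrand \<nu> m x f s z) g y t s) \<longrightarrow>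
         m_translation \<nu> m x (m_conv \<nu> m f g) y = m_conv \<nu> m (m_translation \<nu> m x f) g y)
        \<and>
        (integrable (half_line \<Otimes>\<^sub>M half_line \<Otimes>\<^sub>M half_line)
           (\<lambda>(t, s, z). m_conv_integrand \<nu> m (\<lambda>s. m_translation_integrand \<nu> m x f s z) g y t s) \<longrightarrow>
         integrable (half_line \<Otimes>\<^sub>M half_line \<Otimes>\<^sub>M half_line)
           (\<lambda>(t, z, w). m_conv_integrand \<nu> m f (\<lambda>t. m_translation_integrand \<nu> m x g t w) y t z) \<longrightarrow>
         m_conv \<nu> m (m_translation \<nu> m x f) g y = m_conv \<nu> m f (m_translation \<nu> m x g) y))
     \<and>
     (\<forall>x>0.
        integrable (half_line \<Otimes>\<^sub>M half_line \<Otimes>\<^sub>M half_line \<Otimes>\<^sub>M half_line)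
          (\<lambda>(y, s, t, z). m_conv_integrand \<nu> m (\<lambda>s. m_conv_integrand \<nu> m f g s t z) h x y s) \<longrightarrow>
        integrable (half_line \<Otimes>\<^sub>M half_line \<Otimes>\<^sub>M half_line \<Otimes>\<^sub>M half_line)
          (\<lambda>(y, z, t, w). m_conv_integrand \<nu> m f (\<lambda>y. m_conv_integrand \<nu> m g h y t w) x y z) \<longrightarrow>
        m_conv \<nu> m (m_conv \<nu> m f g) h x = m_conv \<nu> m f (m_conv \<nu> m g h) x)"
proof (intro conjI allI impI, goal_cases)
  case (1 x)
  with assms show ?case by (intro m_conv_commute)
next
  case (2 x y)
  with assms show ?case by (intro m_translation_m_conv_left)
next
  case (3 x y)
  with assms show ?case by (intro m_translation_m_conv_right)
next
  case (4 x)
  with assms show ?case by (intro m_conv_assoc)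
qed

end
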